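(* If $X$ is an analytic space then $\mathcal F_0(X)$ is $\boldsymbol\Sigma^1_2$.
   Context: All spaces are separable metrizable. A space is analytic if it is homeomorphic to an analytic ($\boldsymbol\Sigma^1_1$) subset of a Polish space. A space is zero-dimensional if it has a basis of clopen sets; the empty space counts as zero-dimensional. $\mathcal F(X)$ is the set of all closed subsets of $X$, and $\mathcal F_0(X)\subset\mathcal F(X)$ is the set of all zero-dimensional closed subsets of $X$. $\mathcal F(X)$ is endowed with an admissible topology: take a compact metrizable space $\hat X\supset X$ (with $X$ a subspace, not necessarily dense), identify $F\in\mathcal F(X)$ with its closure $\overline F$ in $\hat X$, and give $\mathcal F(X)$ the topology induced by the Vietoris (Hausdorff metric) topology on the compact subsets of $\hat X$; an admissible topology is one obtained in this way from some $\hat X$. $\boldsymbol\Sigma^1_2$ sets are the projections of co-analytic sets; $\mathcal F_0(X)$ being $\boldsymbol\Sigma^1_2$ means it is a $\boldsymbol\Sigma^1_2$ subset of a (any) Polish space in which $\mathcal F(X)$ embeds (e.g. the space of compact subsets of $\hat X$). *)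

theory Defs
  imports "HOL-Analysis.Analysis"
begin

definition polish :: "'a topology \<Rightarrow> bool" where
  "polish P \<longleftrightarrow> completely_metrizable_space P \<and> separable_space P"

definition baire_space :: "(nat \<Rightarrow> nat) topology" where
  "baire_space = product_topology (\<lambda>_. discrete_topology UNIV) UNIV"

text \<open>The classes are meant for Polish \<open>P\<close>. As usual, projections are taken along the Baire
  space; allowing other Polish factors would not change the classes.\<close>

definition analytic_in :: "'a topology \<Rightarrow> 'a set \<Rightarrow> bool" where
  "analytic_in P A \<longleftrightarrow> (\<exists>C. closedin (prod_topology P baire_space) C \<and> A = fst ` C)"

definition coanalytic_in :: "'a topology \<Rightarrow> 'a set \<Rightarrow> bool" where
  "coanalytic_in P A \<longleftrightarrow> A \<subseteq> topspace P \<and> analytic_in P (topspace P - A)"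

definition sigma12_in :: "'a topology \<Rightarrow> 'a set \<Rightarrow> bool" where
  "sigma12_in P A \<longleftrightarrow> (\<exists>C. coanalytic_in (prod_topology P baire_space) C \<and> A = fst ` C)"

text \<open>HOL cannot quantify existentially over the carrier type of the ambient Polish space, so
  that type is a parameter. A theorem assuming \<open>analytic_space TYPE('p) X\<close> for a type variable
  \<open>'p\<close> covers Polish spaces over every type.\<close>

definition analytic_space :: "'p itself \<Rightarrow> 'a topology \<Rightarrow> bool" where
  "analytic_space (_ :: 'p itself) X \<longleftrightarrow>
    (\<exists>(P :: 'p topology) A. polish P \<and> analytic_in P A \<and> X homeomorphic_space subtopology P A)"

definition zero_dimensional :: "'a topology \<Rightarrow> bool" where
  "zero_dimensional X \<longleftrightarrow>
    (\<exists>\<B>. (\<forall>V\<in>\<B>. openin X V \<and> closedin X V) \<and> openin X = arbitrary union_of (\<lambda>V. V \<in> \<B>))"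

lemma zero_dimensional_iff_dim_le_0: "zero_dimensional X \<longleftrightarrow> X dim_le 0"
proof
  assume "zero_dimensional X"
  then obtain \<B> where B: "\<forall>V\<in>\<B>. openin X V \<and> closedin X V"
    and eq: "openin X = arbitrary union_of (\<lambda>V. V \<in> \<B>)"
    by (auto simp: zero_dimensional_def)
  show "X dim_le 0"
    unfolding dimension_le_0_neighbourhood_base_of_clopen
  proof (subst open_neighbourhood_base_of)
    show "\<forall>S. closedin X S \<and> openin X S \<longrightarrow> openin X S"
      by blast
    show "\<forall>W x. openin X W \<and> x \<in> W \<longrightarrow>
        (\<exists>U. (closedin X U \<and> openin X U) \<and> x \<in> U \<and> U \<subseteq> W)"
      using B eq[unfolded openin_topology_base_unique] by meson
  qed
next
  assume "X dim_le 0"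
  then have "\<forall>W x. openin X W \<and> x \<in> W \<longrightarrow>
        (\<exists>U. (closedin X U \<and> openin X U) \<and> x \<in> U \<and> U \<subseteq> W)"
    unfolding dimension_le_0_neighbourhood_base_of_clopen
    by (subst (asm) open_neighbourhood_base_of) auto
  then show "zero_dimensional X"
    unfolding zero_dimensional_def openin_topology_base_unique
    by (intro exI[of _ "{U. closedin X U \<and> openin X U}"]) auto
qed

definition vietoris :: "'a topology \<Rightarrow> 'a set topology" where
  "vietoris Z = topology_generated_by
     ({{K. compactin Z K \<and> K \<subseteq> U} | U. openin Z U} \<union>
      {{K. compactin Z K \<and> K \<inter> U \<noteq> {}} | U. openin Z U})"

definition closed_sets :: "'a topology \<Rightarrow> 'a set set" where
  "closed_sets X = {F. closedin X F}"

definition zero_dim_closed_sets :: "'a topology \<Rightarrow> 'a set set" where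
  "zero_dim_closed_sets X = {F \<in> closed_sets X. zero_dimensional (subtopology X F)}"

text \<open>For a subspace \<open>X\<close> of a compact metrizable space \<open>Xhat\<close>.\<close>

definition admissible_topology :: "'a topology \<Rightarrow> 'a topology \<Rightarrow> 'a set topology" where
  "admissible_topology Xhat X =
    pullback_topology (closed_sets X) (\<lambda>F. Xhat closure_of F) (vietoris Xhat)"

lemma topspace_vietoris: "topspace (vietoris Z) = {K. compactin Z K}"
proof -
  have "{K. compactin Z K} = {K. compactin Z K \<and> K \<subseteq> topspace Z}"
    by (auto simp: compactin_def)
  moreover have "openin Z (topspace Z)"
    by simp
  ultimately show ?thesis
    unfolding vietoris_def topology_generated_by_topspace by blast
qed

lemma topspace_admissible_topology:
  assumes "compact_space Xhat"
  shows "topspace (admissible_topology Xhat X) = closed_sets X"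
  using assms
  by (auto simp: admissible_topology_def topspace_pullback_topology topspace_vietoris
      closedin_compact_space)

lemma embedding_map_closure_of:
  assumes "compact_space Xhat" "X = subtopology Xhat (topspace X)"
  shows "embedding_map (admissible_topology Xhat X) (vietoris Xhat) (\<lambda>F. Xhat closure_of F)"
proof -
  let ?c = "\<lambda>F. Xhat closure_of F"
  let ?T = "admissible_topology Xhat X"
  have top: "topspace ?T = closed_sets X"
    by (rule topspace_admissible_topology[OF assms(1)])
  have opn: "openin ?T S \<longleftrightarrow> (\<exists>U. openin (vietoris Xhat) U \<and> S = ?c -` U \<inter> closed_sets X)" for S
    by (simp add: admissible_topology_def openin_pullback_topology)
  have rec: "topspace X \<inter> ?c F = F" if "F \<in> closed_sets X" for F
  proof -
    have F: "closedin X F" "F \<subseteq> topspace X"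
      using that closedin_subset by (auto simp: closed_sets_def)
    then have "F = X closure_of F"
      by (simp add: closure_of_closedin)
    also have "\<dots> = topspace X \<inter> ?c F"
      using F(2) assms(2) by (metis closure_of_subtopology inf.absorb_iff2)
    finally show ?thesis by simp
  qed
  have inj: "inj_on ?c (closed_sets X)"
    by (rule inj_onI) (metis rec)
  have img: "?c ` closed_sets X \<subseteq> topspace (vietoris Xhat)"
    using assms(1) by (auto simp: topspace_vietoris closedin_compact_space)
  have cont: "continuous_map ?T (vietoris Xhat) ?c"
    unfolding continuous_map_def top opn using img by auto
  have "open_map ?T (subtopology (vietoris Xhat) (?c ` closed_sets X)) ?c"
    unfolding open_map_def opn openin_subtopology by blast
  then show ?thesis
    unfolding embedding_map_def top
    using cont inj img
    by (intro bijective_open_imp_homeomorphic_map)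
      (auto simp: top continuous_map_in_subtopology inj_on_def)
qed

end

theory Submission
  imports Defs
begin

text \<open>Let \<open>Z\<close> be the compact space \<open>Xhat\<close> and \<open>f\<close> a continuous map from the Baire space onto
  \<open>X\<close> (assumed nonempty). A set \<open>F\<close> is zero-dimensional iff there are open sets of \<open>Z\<close> which cut
  \<open>F\<close> into complementary clopen pairs in such a way that every basic open set meets \<open>F\<close> in a union
  of these clopen pieces. Such a family of open sets is coded by a point of the Baire space, and
  whether the coded family works can be tested at each point \<open>f c\<close> of \<open>F\<close> by a Borel condition.
  A compact set \<open>K\<close> is the closure of \<open>K \<inter> topspace X\<close> iff some sequence of points \<open>f y\<close> in \<open>K\<close>
  meets every basic open set which \<open>K\<close> meets. Hence \<open>K\<close> is the closure of a zero-dimensional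
  closed subset of \<open>X\<close> iff there is a code such that, for all \<open>c\<close>, a Borel condition holds.

  For another embedding \<open>e\<close> into a Polish space no Lavrentiev extension is needed: the points of
  the closure of the graph \<open>{(e F, closure of F)}\<close> whose second coordinate is the closure of some
  \<open>F\<close> lie on the graph itself, so the image under \<open>e\<close> is a projection of a
  \<open>\<Sigma>\<^sup>1\<^sub>2\<close> set.\<close>

subsection \<open>Analytic sets\<close>

lemma baire_space_eq_euclidean: "baire_space = euclidean"
proof -
  have "discrete_topology (UNIV :: nat set) = euclidean"
    by (simp add: discrete_topology_unique_alt open_discrete)
  then show ?thesis
    by (simp add: baire_space_def euclidean_product_topology)
qed

lemma topspace_baire_space [simp]: "topspace baire_space = UNIV"
  by (simp add: baire_space_eq_euclidean)

lemma completely_metrizable_baire_space: "completely_metrizable_space baire_space"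
  by (simp add: baire_space_def completely_metrizable_space_product_topology
      completely_metrizable_space_discrete_topology)

lemma metrizable_baire_space: "metrizable_space baire_space"
  by (rule completely_metrizable_imp_metrizable_space[OF completely_metrizable_baire_space])

lemma metrizable_prod_baire: "metrizable_space P \<Longrightarrow> metrizable_space (prod_topology P baire_space)"
  by (simp add: metrizable_space_prod_topology metrizable_baire_space)

lemma continuous_map_into_baire:
  "continuous_map X baire_space f \<longleftrightarrow>
    (\<forall>k. continuous_map X (discrete_topology UNIV) (\<lambda>x. f x k))"
  by (simp add: baire_space_def continuous_map_componentwise_UNIV)

lemma continuous_map_baire_coord:
  "continuous_map X baire_space f \<Longrightarrow> continuous_map X (discrete_topology UNIV) (\<lambda>x. f x k)"
  by (simp add: continuous_map_into_baire)

lemma continuous_map_into_discrete: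
  "continuous_map X (discrete_topology UNIV) g \<longleftrightarrow> (\<forall>n. openin X {x \<in> topspace X. g x = n})"
proof
  assume g: "continuous_map X (discrete_topology UNIV) g"
  show "\<forall>n. openin X {x \<in> topspace X. g x = n}"
    using openin_continuous_map_preimage[OF g, of "{_}"] by simp
next
  assume R: "\<forall>n. openin X {x \<in> topspace X. g x = n}"
  have "{x \<in> topspace X. g x \<in> U} = (\<Union>n\<in>U. {x \<in> topspace X. g x = n})" for U
    by auto
  then show "continuous_map X (discrete_topology UNIV) g"
    using R by (auto simp: continuous_map_def intro!: openin_Union)
qed

text \<open>Reads a point of the Baire space as a sequence of such points, so that a single
  quantifier over the Baire space can carry countably many witnesses. Nesting \<open>col\<close>
  gives double and triple sequences.\<close>

definition col :: "(nat \<Rightarrow> nat) \<Rightarrow> nat \<Rightarrow> nat \<Rightarrow> nat" where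
  "col y n k = y (prod_encode (n, k))"

definition of_cols :: "(nat \<Rightarrow> nat \<Rightarrow> nat) \<Rightarrow> nat \<Rightarrow> nat" where
  "of_cols z i = (case prod_decode i of (n, k) \<Rightarrow> z n k)"

lemma col_of_cols [simp]: "col (of_cols z) n = z n"
  by (simp add: col_def of_cols_def fun_eq_iff)

lemma continuous_map_col:
  assumes "continuous_map X baire_space f"
  shows "continuous_map X baire_space (\<lambda>x. col (f x) n)"
  using assms by (simp add: continuous_map_into_baire col_def)

section \<open>Closure properties of analytic sets\<close>

lemma analytic_inI:
  assumes "closedin (prod_topology P baire_space) {z \<in> topspace P \<times> UNIV. \<phi> (fst z) (snd z)}"
  shows "analytic_in P {p \<in> topspace P. \<exists>y. \<phi> p y}"
  unfolding analytic_in_def by (rule exI, rule conjI, rule assms) (auto simp: image_iff)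

lemma analytic_inE:
  assumes "analytic_in P A"
  obtains C where "closedin (prod_topology P baire_space) C"
    "\<And>p. p \<in> A \<longleftrightarrow> p \<in> topspace P \<and> (\<exists>y. (p, y) \<in> C)"
proof -
  obtain C where C: "closedin (prod_topology P baire_space) C" "A = fst ` C"
    using assms by (auto simp: analytic_in_def)
  then have "C \<subseteq> topspace P \<times> UNIV"
    using closedin_subset by fastforce
  then have "p \<in> A \<longleftrightarrow> p \<in> topspace P \<and> (\<exists>y. (p, y) \<in> C)" for p
    unfolding C(2) by (auto simp: image_iff intro: bexI[rotated])
  with C(1) show thesis by (rule that)
qed

lemma analytic_in_subset: "analytic_in P A \<Longrightarrow> A \<subseteq> topspace P"
  by (elim analytic_inE) auto

lemma analytic_in_closedin:
  assumes "closedin P A" shows "analytic_in P A"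
proof -
  have "closedin (prod_topology P baire_space) {z \<in> topspace (prod_topology P baire_space). fst z \<in> A}"
    using assms by (intro closedin_continuous_map_preimage[OF continuous_map_fst])
  then have "analytic_in P {p \<in> topspace P. \<exists>y::nat\<Rightarrow>nat. p \<in> A}"
    by (intro analytic_inI) simp
  moreover have "{p \<in> topspace P. \<exists>y::nat\<Rightarrow>nat. p \<in> A} = A"
    using closedin_subset[OF assms] by auto
  ultimately show ?thesis by simp
qed

lemma analytic_in_preimage:
  assumes "continuous_map Q P g" "analytic_in P A"
  shows "analytic_in Q {q \<in> topspace Q. g q \<in> A}"
proof -
  obtain C where C: "closedin (prod_topology P baire_space) C"
    "\<And>p. p \<in> A \<longleftrightarrow> p \<in> topspace P \<and> (\<exists>y. (p, y) \<in> C)"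
    using analytic_inE[OF assms(2)] by blast
  have "continuous_map (prod_topology Q baire_space) (prod_topology P baire_space) (\<lambda>z. (g (fst z), snd z))"
    by (intro continuous_map_pairedI continuous_map_snd
      continuous_map_compose[OF continuous_map_fst assms(1), unfolded o_def])
  from closedin_continuous_map_preimage[OF this C(1)]
  have "analytic_in Q {q \<in> topspace Q. \<exists>y. (g q, y) \<in> C}"
    by (intro analytic_inI) simp
  moreover have "{q \<in> topspace Q. \<exists>y. (g q, y) \<in> C} = {q \<in> topspace Q. g q \<in> A}"
    using C(2) continuous_map_funspace[OF assms(1)] by auto
  ultimately show ?thesis by simp
qed

text \<open>The first entry of the new witness names the index \<open>n\<close>, and the shifted
  remainder is a witness for \<open>A n\<close>. The resulting set is closed because the first entry
  is locally constant.\<close>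

lemma analytic_in_UN:
  assumes "\<And>n::nat. analytic_in P (A n)"
  shows "analytic_in P (\<Union>n. A n)"
proof -
  have "\<exists>C. \<forall>n. closedin (prod_topology P baire_space) (C n) \<and>
     (\<forall>p. p \<in> A n \<longleftrightarrow> p \<in> topspace P \<and> (\<exists>y. (p, y) \<in> C n))"
    by (rule choice, rule allI, rule analytic_inE[OF assms]) blast
  then obtain C where C: "\<And>n. closedin (prod_topology P baire_space) (C n)"
     "\<And>n p. p \<in> A n \<longleftrightarrow> p \<in> topspace P \<and> (\<exists>y. (p, y) \<in> C n)"
    by metis
  let ?P = "prod_topology P baire_space"
  have cont: "continuous_map ?P ?P (\<lambda>z. (fst z, \<lambda>k. snd z (Suc k)))"
    using continuous_map_snd[of P baire_space]
    by (intro continuous_map_pairedI continuous_map_fst) (simp add: continuous_map_into_baire)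
  \<comment> \<open>The complement of the intended closed set is cut into slices by the value of
    \<open>snd z 0\<close>; on each slice only one fixed \<open>C n\<close> is involved.\<close>
  have op: "openin ?P {z \<in> topspace ?P. snd z 0 = n \<and> (fst z, \<lambda>k. snd z (Suc k)) \<notin> C n}" for n
  proof -
    have "openin ?P {z \<in> topspace ?P. snd z 0 = n}"
      using continuous_map_baire_coord[OF continuous_map_snd[of P baire_space], of 0]
      by (simp only: continuous_map_into_discrete)
    moreover have "openin ?P {z \<in> topspace ?P. (fst z, \<lambda>k. snd z (Suc k)) \<in> topspace ?P - C n}"
      by (intro openin_continuous_map_preimage[OF cont] openin_diff openin_topspace C(1))
    ultimately have "openin ?P ({z \<in> topspace ?P. snd z 0 = n} \<inter>
        {z \<in> topspace ?P. (fst z, \<lambda>k. snd z (Suc k)) \<in> topspace ?P - C n})" by blast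
    then show ?thesis by (rule back_subst[of "openin ?P"]) auto
  qed
  have "closedin ?P (topspace ?P - (\<Union>n. {z \<in> topspace ?P. snd z 0 = n \<and> (fst z, \<lambda>k. snd z (Suc k)) \<notin> C n}))"
    using op by blast
  then have "closedin ?P {z \<in> topspace P \<times> UNIV. (fst z, \<lambda>k. snd z (Suc k)) \<in> C (snd z 0)}"
    by (rule back_subst[of "closedin ?P"]) auto
  then have "analytic_in P {p \<in> topspace P. \<exists>y. (p, \<lambda>k. y (Suc k)) \<in> C (y 0)}"
    by (intro analytic_inI) auto
  moreover have "{p \<in> topspace P. \<exists>y. (p, \<lambda>k. y (Suc k)) \<in> C (y 0)} = (\<Union>n. A n)"
  proof -
    have "\<exists>y. (p, \<lambda>k. y (Suc k)) \<in> C (y 0)" if "(p, y) \<in> C n" for p y n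
      using that by (intro exI[of _ "case_nat n y"]) simp
    then show ?thesis by (auto simp: C(2)) fast
  qed
  ultimately show ?thesis by simp
qed

text \<open>Witnesses for all the \<open>A n\<close> are chosen simultaneously and packed as the
  columns of one point.\<close>

lemma analytic_in_INT:
  assumes "\<And>n::nat. analytic_in P (A n)"
  shows "analytic_in P (\<Inter>n. A n)"
proof -
  have "\<exists>C. \<forall>n. closedin (prod_topology P baire_space) (C n) \<and>
     (\<forall>p. p \<in> A n \<longleftrightarrow> p \<in> topspace P \<and> (\<exists>y. (p, y) \<in> C n))"
    by (rule choice, rule allI, rule analytic_inE[OF assms]) blast
  then obtain C where C: "\<And>n. closedin (prod_topology P baire_space) (C n)"
     "\<And>n p. p \<in> A n \<longleftrightarrow> p \<in> topspace P \<and> (\<exists>y. (p, y) \<in> C n)"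
    by metis
  let ?P = "prod_topology P baire_space"
  have cont: "continuous_map ?P ?P (\<lambda>z. (fst z, col (snd z) n))" for n
    by (intro continuous_map_pairedI continuous_map_fst continuous_map_col continuous_map_snd)
  have "closedin ?P (\<Inter>n. {z \<in> topspace ?P. (fst z, col (snd z) n) \<in> C n})"
    using closedin_continuous_map_preimage[OF cont C(1)] by (intro closedin_Inter) auto
  then have "closedin ?P {z \<in> topspace P \<times> UNIV. \<forall>n. (fst z, col (snd z) n) \<in> C n}"
    by (rule back_subst[of "closedin ?P"]) auto
  then have "analytic_in P {p \<in> topspace P. \<exists>y. \<forall>n. (p, col y n) \<in> C n}"
    by (intro analytic_inI) auto
  moreover have "{p \<in> topspace P. \<exists>y. \<forall>n. (p, col y n) \<in> C n} = (\<Inter>n. A n)"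
  proof -
    have "\<exists>y. \<forall>n. (p, col y n) \<in> C n" if "\<forall>n. \<exists>y. (p, y) \<in> C n" for p
    proof -
      from choice[OF that] obtain z where "\<forall>n. (p, z n) \<in> C n" by blast
      then show ?thesis by (intro exI[of _ "of_cols z"]) simp
    qed
    moreover have "\<exists>y. (p, y) \<in> C n" if "\<forall>n. (p, col y n) \<in> C n" for p y n
      using that by (intro exI[of _ "col y n"]) simp
    ultimately show ?thesis by (auto simp: C(2))
  qed
  ultimately show ?thesis by simp
qed

lemma analytic_in_Un:
  assumes "analytic_in P A" "analytic_in P B" shows "analytic_in P (A \<union> B)"
proof -
  have "analytic_in P (\<Union>n::nat. if n = 0 then A else B)"
    by (rule analytic_in_UN) (use assms in auto)
  moreover have "(\<Union>n::nat. if n = 0 then A else B) = A \<union> B" by (auto split: if_splits)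
  ultimately show ?thesis by simp
qed

lemma analytic_in_Int:
  assumes "analytic_in P A" "analytic_in P B" shows "analytic_in P (A \<inter> B)"
proof -
  have "analytic_in P (\<Inter>n::nat. if n = 0 then A else B)"
    by (rule analytic_in_INT) (use assms in auto)
  moreover have "(\<Inter>n::nat. if n = 0 then A else B) = A \<inter> B" by (auto split: if_splits)
  ultimately show ?thesis by simp
qed

text \<open>In a metrizable space an open set is a countable union of closed sets.\<close>

lemma analytic_in_openin:
  assumes "metrizable_space P" "openin P U" shows "analytic_in P U"
proof -
  obtain C where "\<And>n::nat. closedin P (C n)" "\<Union> (range C) = U"
    using open_imp_fsigma_in[OF assms] by (auto simp: fsigma_in_ascending)
  then show ?thesis
    using analytic_in_UN[of P C] analytic_in_closedin by blast
qed

text \<open>The projected coordinate and the witness for \<open>A\<close> merge into columns 0 and 1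
  of one witness.\<close>

lemma analytic_in_fst_image:
  assumes "analytic_in (prod_topology P baire_space) A"
  shows "analytic_in P (fst ` A)"
proof -
  obtain C where C: "closedin (prod_topology (prod_topology P baire_space) baire_space) C"
    "\<And>p. p \<in> A \<longleftrightarrow> p \<in> topspace (prod_topology P baire_space) \<and> (\<exists>y. (p, y) \<in> C)"
    using analytic_inE[OF assms] by blast
  let ?P = "prod_topology P baire_space"
  have "continuous_map ?P (prod_topology ?P baire_space) (\<lambda>z. ((fst z, col (snd z) 0), col (snd z) 1))"
    by (intro continuous_map_pairedI continuous_map_fst continuous_map_snd continuous_map_col)
  from closedin_continuous_map_preimage[OF this C(1)]
  have "analytic_in P {p \<in> topspace P. \<exists>y. ((p, col y 0), col y 1) \<in> C}"
    by (intro analytic_inI) simp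
  moreover have "{p \<in> topspace P. \<exists>y. ((p, col y 0), col y 1) \<in> C} = fst ` A"
  proof -
    have "\<exists>y. ((p, col y 0), col y 1) \<in> C" if "((p, y), z) \<in> C" for p y z
      using that by (intro exI[of _ "of_cols (\<lambda>n. if n = 0 then y else z)"]) simp
    moreover have "fst ` A = {p. \<exists>y. (p, y) \<in> A}" by force
    ultimately show ?thesis by (auto simp: C(2))
  qed
  ultimately show ?thesis by simp
qed

section \<open>Analyticity read off from the form of the defining formula\<close>

lemma analytic_in_Collect_ex_nat:
  assumes "\<And>n::nat. analytic_in P {p \<in> topspace P. \<phi> n p}"
  shows "analytic_in P {p \<in> topspace P. \<exists>n. \<phi> n p}"
  using analytic_in_UN[OF assms] by (rule back_subst[of "analytic_in P"]) auto

lemma analytic_in_Collect_all_nat: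
  assumes "\<And>n::nat. analytic_in P {p \<in> topspace P. \<phi> n p}"
  shows "analytic_in P {p \<in> topspace P. \<forall>n. \<phi> n p}"
  using analytic_in_INT[OF assms] by (rule back_subst[of "analytic_in P"]) auto

lemma analytic_in_Collect_disj:
  assumes "analytic_in P {p \<in> topspace P. \<phi> p}" "analytic_in P {p \<in> topspace P. \<psi> p}"
  shows "analytic_in P {p \<in> topspace P. \<phi> p \<or> \<psi> p}"
  using analytic_in_Un[OF assms] by (rule back_subst[of "analytic_in P"]) auto

lemma analytic_in_Collect_conj:
  assumes "analytic_in P {p \<in> topspace P. \<phi> p}" "analytic_in P {p \<in> topspace P. \<psi> p}"
  shows "analytic_in P {p \<in> topspace P. \<phi> p \<and> \<psi> p}"
  using analytic_in_Int[OF assms] by (rule back_subst[of "analytic_in P"]) auto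

text \<open>Open conditions and their negations are the atoms: once negations are pushed inward to
  them, the rules for countable connectives show that a Borel condition is analytic.\<close>

lemma analytic_in_Collect_openin:
  assumes "metrizable_space P" "openin P {p \<in> topspace P. \<phi> p}"
  shows "analytic_in P {p \<in> topspace P. \<phi> p}"
    and "analytic_in P {p \<in> topspace P. \<not> \<phi> p}"
proof -
  show "analytic_in P {p \<in> topspace P. \<phi> p}"
    using assms by (rule analytic_in_openin)
  have "closedin P (topspace P - {p \<in> topspace P. \<phi> p})"
    using assms(2) by blast
  then have "closedin P {p \<in> topspace P. \<not> \<phi> p}"
    by (rule back_subst[of "closedin P"]) auto
  then show "analytic_in P {p \<in> topspace P. \<not> \<phi> p}"
    by (rule analytic_in_closedin)
qed

lemma analytic_in_Collect_ex_baire: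
  assumes "analytic_in (prod_topology P baire_space)
    {z \<in> topspace (prod_topology P baire_space). \<phi> (fst z) (snd z)}"
  shows "analytic_in P {p \<in> topspace P. \<exists>y. \<phi> p y}"
  using analytic_in_fst_image[OF assms]
  by (rule back_subst[of "analytic_in P"]) (force simp: image_iff)

lemma sigma12_inI:
  assumes "analytic_in (prod_topology P baire_space)
    {z \<in> topspace (prod_topology P baire_space). \<not> \<phi> (fst z) (snd z)}"
  shows "sigma12_in P {p \<in> topspace P. \<exists>y. \<phi> p y}"
proof -
  let ?P = "prod_topology P baire_space"
  let ?C = "{z \<in> topspace ?P. \<phi> (fst z) (snd z)}"
  have "topspace ?P - ?C = {z \<in> topspace ?P. \<not> \<phi> (fst z) (snd z)}" by auto
  with assms have "coanalytic_in ?P ?C"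
    by (auto simp: coanalytic_in_def)
  moreover have "fst ` ?C = {p \<in> topspace P. \<exists>y. \<phi> p y}"
    by (force simp: image_iff)
  ultimately show ?thesis unfolding sigma12_in_def by (intro exI[of _ ?C]) simp
qed

subsection \<open>Continuous images of the Baire space\<close>

text \<open>A point \<open>y\<close> lists indices of dense points and steers a Cauchy sequence
  \<open>x y\<close> with limit \<open>f y\<close>. The term \<open>x y k\<close> depends only on
  the entries of \<open>y\<close> up to \<open>k\<close> and lies within \<open>2*(1/2)^k\<close> of
  the limit, which gives continuity. Every point is reached through dense points approaching it fast
  enough.\<close>

lemma continuous_surjection_from_baire:
  assumes "polish P" "topspace P \<noteq> {}"
  obtains f where "continuous_map baire_space P f" "range f = topspace P"
proof -
  obtain M d where "Metric_space M d" and cpl: "Metric_space.mcomplete M d"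
    and P: "P = Metric_space.mtopology M d"
    using assms(1) by (auto simp: polish_def completely_metrizable_space_def)
  interpret Metric_space M d by fact
  obtain D where D: "countable D" "D \<subseteq> M" "mtopology closure_of D = M"
    using assms(1) P by (auto simp: polish_def separable_space_def)
  have "M \<noteq> {}" using assms(2) P by simp
  then have "D \<noteq> {}" using D(3) by auto
  define e where "e = from_nat_into D"
  have e: "e n \<in> M" for n
    using from_nat_into[OF \<open>D \<noteq> {}\<close>] D(2) by (auto simp: e_def)
  have e_dense: "\<exists>n. d p (e n) < r" if "p \<in> M" "r > 0" for p r
  proof -
    have "p \<in> mtopology closure_of D" using that D(3) by simp
    then have "\<exists>q\<in>D. q \<in> mball p r"
      using \<open>r > 0\<close> unfolding metric_closure_of by blast
    then obtain q where "q \<in> D" "d p q < r" by auto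
    then show ?thesis
      using from_nat_into_surj[OF D(1)] by (auto simp: e_def)
  qed
  \<comment> \<open>The Cauchy sequence coded by \<open>y\<close>: move to the next prescribed point of the dense set
    unless it is too far away.\<close>
  define x where "x y = rec_nat (e (y 0))
    (\<lambda>k p. if d p (e (y (Suc k))) < (1/2)^k then e (y (Suc k)) else p)" for y
  have x_0: "x y 0 = e (y 0)" for y by (simp add: x_def)
  have x_Suc: "x y (Suc k) = (if d (x y k) (e (y (Suc k))) < (1/2)^k then e (y (Suc k)) else x y k)" for y k
    by (simp add: x_def)
  have xM: "x y k \<in> M" for y k
    by (induction k) (auto simp: x_0 x_Suc e)
  have step: "d (x y k) (x y (Suc k)) \<le> (1/2)^k" for y k
    using xM[of y k] by (auto simp: x_Suc)
  \<comment> \<open>The subtracted term makes the induction exact: one more step costs at most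
    \<open>(1/2)^(k+m)\<close>, which is just the increase of the bound.\<close>
  have dist: "d (x y k) (x y (k+m)) \<le> 2*(1/2)^k - 2*(1/2)^(k+m)" for y k m
  proof (induction m)
    case 0 then show ?case using xM by simp
  next
    case (Suc m)
    then show ?case
      using triangle[OF xM[of y k] xM[of y "k+m"] xM[of y "Suc (k+m)"]] step[of y "k+m"] by simp
  qed
  have dist': "d (x y k) (x y n) \<le> 2*(1/2)^k" if "k \<le> n" for y k n
    using dist[of y k "n-k"] that by (simp add: order_trans)
  have small: "\<exists>k. c*(1/2::real)^k < r" if "r > 0" "c > 0" for r c
    using real_arch_pow_inv[of "r/c" "1/2"] that by (auto simp: field_simps)
  have "MCauchy (x y)" for y
    unfolding MCauchy_def
  proof (intro conjI allI impI)
    show "range (x y) \<subseteq> M" using xM by auto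
    fix r :: real assume "r > 0"
    then obtain k where k: "4*(1/2)^k < r" using small[of r 4] by auto
    have "d (x y n) (x y n') < r" if "k \<le> n" "k \<le> n'" for n n'
      using triangle[OF xM[of y n] xM[of y k] xM[of y n']] dist'[of k n y] dist'[of k n' y] that k
      by (simp add: commute)
    then show "\<exists>k. \<forall>n n'. k \<le> n \<longrightarrow> k \<le> n' \<longrightarrow> d (x y n) (x y n') < r" by blast
  qed
  then have "\<exists>l. limitin mtopology (x y) l sequentially" for y
    using cpl by (auto simp: mcomplete_def)
  then obtain f where f: "\<And>y. limitin mtopology (x y) (f y) sequentially" by metis
  have fM: "f y \<in> M" for y using f limitin_mspace by blast
  have approx: "d (x y k) (f y) \<le> 2*(1/2)^k" for y k
  proof (rule field_le_epsilon)
    fix r :: real assume "r > 0"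
    then obtain n where n: "\<forall>m\<ge>n. d (x y m) (f y) < r"
      using f[of y] \<open>r > 0\<close> unfolding limit_metric_sequentially by blast
    show "d (x y k) (f y) \<le> 2*(1/2)^k + r"
      using triangle[OF xM[of y k] xM[of y "max n k"] fM[of y]] n[rule_format, of "max n k"]
        dist'[of k "max n k" y] by simp
  qed
  have cont: "continuous_map baire_space P f"
    unfolding continuous_map_def
  proof (intro conjI allI impI)
    show "f \<in> topspace baire_space \<rightarrow> topspace P" using fM P by simp
    fix U assume "openin P U"
    show "openin baire_space {y \<in> topspace baire_space. f y \<in> U}"
    proof (subst openin_subopen, intro ballI)
      fix y assume "y \<in> {y \<in> topspace baire_space. f y \<in> U}"
      then obtain r where r: "r > 0" "mball (f y) r \<subseteq> U"
        using \<open>openin P U\<close> P by (auto simp: openin_mtopology)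
      obtain k where k: "4*(1/2)^k < r" using small[of r 4] r by auto
      \<comment> \<open>On \<open>?N\<close> the first \<open>k\<close> steps of the construction
        agree with those for \<open>y\<close>, so both limits are within \<open>2*(1/2)^k\<close> of
        the same point \<open>x y k\<close>.\<close>
      let ?N = "topspace baire_space \<inter> (\<Inter>i\<le>k. {y' \<in> topspace baire_space. y' i = y i})"
      have "openin baire_space {y' \<in> topspace baire_space. y' i = y i}" for i
        using continuous_map_baire_coord[OF continuous_map_id[of baire_space, unfolded id_def], of i]
        by (simp only: continuous_map_into_discrete)
      then have "openin baire_space ?N"
        by (intro openin_Int_Inter openin_topspace) auto
      moreover have "f y' \<in> U" if "y' \<in> ?N" for y'
      proof -
        have "x y' i = x y i" if "i \<le> k" for i
          using that \<open>y' \<in> ?N\<close> by (induction i) (auto simp: x_0 x_Suc)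
        then have "x y' k = x y k" by simp
        then have "d (f y) (f y') < r"
          using triangle[OF fM[of y] xM[of y k] fM[of y']] approx[of y k] approx[of y' k] k
          by (simp add: commute)
        then show ?thesis using r fM by auto
      qed
      ultimately show "\<exists>T. openin baire_space T \<and> y \<in> T \<and> T \<subseteq> {y \<in> topspace baire_space. f y \<in> U}"
        by (intro exI[of _ ?N]) auto
    qed
  qed
  have "p \<in> range f" if "p \<in> M" for p
  proof -
    have "\<exists>n. d p (e n) < (1/2)^(k+2)" for k
      by (rule e_dense[OF that]) simp
    \<comment> \<open>With the exponent \<open>k+2\<close>, consecutive chosen points are closer
      than \<open>(1/2)^k\<close>, so every prescribed move is carried out.\<close>
    then obtain y where y: "\<And>k. d p (e (y k)) < (1/2)^(k+2)" by metis
    have xe: "x y k = e (y k)" for k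
    proof (induction k)
      case (Suc k)
      have "d (e (y k)) (e (y (Suc k))) \<le> d p (e (y k)) + d p (e (y (Suc k)))"
        using triangle''[OF e that e] by (metis commute)
      also have "\<dots> < (1/2)^(k+2) + (1/2)^(Suc k+2)"
        by (intro add_strict_mono y)
      also have "\<dots> \<le> (1/2)^k" by (simp add: field_simps)
      finally show ?case using Suc by (simp add: x_Suc)
    qed (simp add: x_0)
    have "d p (f y) \<le> 0 + r" if "r > 0" for r
    proof -
      obtain k where k: "4*(1/2)^k < r" using small[of r 4] \<open>r > 0\<close> by auto
      have "(1/2::real)^(k+2) \<le> 1*(1/2)^k" by (simp add: field_simps)
      then have "d p (x y k) \<le> (1/2)^k" using y[of k] by (simp only: xe)
      then show ?thesis
        using triangle[OF \<open>p \<in> M\<close> xM[of y k] fM[of y]] approx[of y k] k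
          zero_le_power[of "1/2::real" k] by linarith
    qed
    then have "d p (f y) \<le> 0" by (rule field_le_epsilon)
    then show ?thesis using \<open>p \<in> M\<close> fM by (metis mdist_pos_less not_le rangeI)
  qed
  with fM P show thesis by (intro that[OF cont]) auto
qed

lemma polish_closedin:
  assumes "completely_metrizable_space X" "second_countable X" "closedin X S"
  shows "polish (subtopology X S)"
  using assms by (simp add: polish_def completely_metrizable_space_closedin
      second_countable_imp_separable_space second_countable_subtopology)

lemma second_countable_euclidean:
  "second_countable (euclidean :: 'a::second_countable_topology topology)"
proof -
  obtain B :: "'a set set" where "countable B" "topological_basis B"
    using ex_countable_basis by blast
  then show ?thesis
    unfolding second_countable_def
    by (metis open_openin topological_basisE topological_basis_open)
qed

text \<open>An analytic set is the projection of a closed set in \<open>P\<close> times the Baire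
  space. Pulled back along a surjection onto \<open>P\<close>, this closed set becomes a closed
  \<open>D\<close> in the Baire space; \<open>D\<close> is Polish, hence itself an image of the
  Baire space. The conclusion no longer mentions the ambient type \<open>'p\<close>.\<close>

lemma analytic_space_continuous_surjection:
  assumes "analytic_space TYPE('p) X" "topspace X \<noteq> {}"
  obtains f where "continuous_map baire_space X f" "range f = topspace X"
proof -
  obtain P :: "'p topology" and A where P: "polish P" "analytic_in P A"
    "X homeomorphic_space subtopology P A"
    using assms(1) unfolding analytic_space_def by auto
  obtain C where C: "closedin (prod_topology P baire_space) C"
    "\<And>p. p \<in> A \<longleftrightarrow> p \<in> topspace P \<and> (\<exists>y. (p, y) \<in> C)"
    using analytic_inE[OF P(2)] by blast
  have topA: "topspace (subtopology P A) = A"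
    using analytic_in_subset[OF P(2)] by (simp add: inf.absorb2)
  obtain h where h: "homeomorphic_map (subtopology P A) X h"
    using P(3) homeomorphic_space homeomorphic_space_sym by blast
  have hA: "h ` A = topspace X"
    using homeomorphic_imp_surjective_map[OF h] topA by simp
  have "topspace P \<noteq> {}"
    using hA assms(2) analytic_in_subset[OF P(2)] by (metis image_is_empty subset_empty)
  then obtain q where q: "continuous_map baire_space P q" "range q = topspace P"
    using continuous_surjection_from_baire[OF P(1)] by blast
  \<comment> \<open>Column 0 codes a point of \<open>P\<close> through \<open>q\<close>; column 1 is
    the witness that this point is in \<open>A\<close>.\<close>
  define D where "D = {y \<in> topspace baire_space. (q (col y 0), col y 1) \<in> C}"
  have col: "continuous_map baire_space baire_space (\<lambda>y. col y n)" for n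
    using continuous_map_col[OF continuous_map_id[of baire_space, unfolded id_def]] .
  have qc: "continuous_map baire_space P (\<lambda>y. q (col y 0))"
    using continuous_map_compose[OF col q(1)] by (simp add: o_def)
  have "closedin baire_space D"
    unfolding D_def by (intro closedin_continuous_map_preimage[OF _ C(1)] continuous_map_pairedI qc col)
  then have pol: "polish (subtopology baire_space D)"
    by (intro polish_closedin completely_metrizable_baire_space)
      (simp_all add: baire_space_eq_euclidean second_countable_euclidean)
  have qD: "(\<lambda>y. q (col y 0)) ` D = A"
  proof
    show "(\<lambda>y. q (col y 0)) ` D \<subseteq> A"
    proof (intro image_subsetI)
      fix y assume "y \<in> D"
      then have "\<exists>z. (q (col y 0), z) \<in> C" unfolding D_def by blast
      with q(2) show "q (col y 0) \<in> A" by (auto simp: C(2))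
    qed
    show "A \<subseteq> (\<lambda>y. q (col y 0)) ` D"
    proof
      fix p assume "p \<in> A"
      then have "p \<in> range q" "\<exists>z. (p, z) \<in> C" using q(2) by (simp_all add: C(2))
      then obtain y z where "p = q y" "(p, z) \<in> C" by blast
      then show "p \<in> (\<lambda>y. q (col y 0)) ` D"
        by (intro image_eqI[of _ _ "of_cols (\<lambda>n. if n = 0 then y else z)"]) (auto simp: D_def)
    qed
  qed
  have "topspace (subtopology baire_space D) \<noteq> {}"
    using qD hA assms(2) by (metis \<open>closedin baire_space D\<close> closedin_subset image_is_empty topspace_subtopology_subset)
  then obtain g where g: "continuous_map baire_space (subtopology baire_space D) g"
    "range g = topspace (subtopology baire_space D)"
    using continuous_surjection_from_baire[OF pol] by blast
  have gD: "range g = D" using g(2) by simp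
  have "continuous_map baire_space (subtopology P A) (\<lambda>y. q (col (g y) 0))"
    using continuous_map_compose[OF continuous_map_into_fulltopology[OF g(1)] qc] gD qD
    by (auto simp: continuous_map_in_subtopology o_def)
  from continuous_map_compose[OF this homeomorphic_imp_continuous_map[OF h]]
  have "continuous_map baire_space X (\<lambda>y. h (q (col (g y) 0)))" by (simp add: o_def)
  moreover have "range (\<lambda>y. h (q (col (g y) 0))) = topspace X"
  proof -
    have "range (\<lambda>y. h (q (col (g y) 0))) = h ` (\<lambda>y. q (col y 0)) ` range g"
      by (simp add: image_image)
    then show ?thesis by (simp only: gD qD hA)
  qed
  ultimately show thesis by (rule that)
qed

text \<open>The quantifier over \<open>V\<close> turns into one over the Baire space by a surjection
  \<open>q\<close> and merges with the quantifier already present in \<open>S\<close>. Membership in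
  the closed set \<open>G\<close> has an open, hence analytic, negation and so does not raise the
  complexity.\<close>

lemma sigma12_in_projection:
  assumes "polish V" "metrizable_space P" "sigma12_in V S" "closedin (prod_topology P V) G"
  shows "sigma12_in P {p \<in> topspace P. \<exists>K\<in>S. (p, K) \<in> G}"
proof -
  obtain C where C: "coanalytic_in (prod_topology V baire_space) C" "S = fst ` C"
    using assms(3) by (auto simp: sigma12_in_def)
  have Csub: "C \<subseteq> topspace V \<times> UNIV"
    and Cco: "analytic_in (prod_topology V baire_space) (topspace (prod_topology V baire_space) - C)"
    using C(1) by (auto simp: coanalytic_in_def)
  have mP: "metrizable_space (prod_topology P baire_space)"
    using assms(2) by (rule metrizable_prod_baire)
  show ?thesis
  proof (cases "topspace V = {}")
    case True
    then have "S = {}" using Csub C(2) by auto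
    have "sigma12_in P {p \<in> topspace P. \<exists>y::nat \<Rightarrow> nat. False}"
      by (rule sigma12_inI)
        (metis analytic_in_closedin closedin_topspace Collect_mem_eq simp_thms(8,21))
    with \<open>S = {}\<close> show ?thesis by simp
  next
    case False
    then obtain q where q: "continuous_map baire_space V q" "range q = topspace V"
      using continuous_surjection_from_baire[OF assms(1)] by blast
    let ?P = "prod_topology P baire_space"
    have col: "continuous_map ?P baire_space (\<lambda>z. col (snd z) n)" for n
      by (intro continuous_map_col continuous_map_snd)
    have qcol: "continuous_map ?P V (\<lambda>z. q (col (snd z) 0))"
      using continuous_map_compose[OF col q(1)] by (simp add: o_def)
    let ?\<phi> = "\<lambda>p y. (q (col y 0), col y 1) \<in> C \<and> (p, q (col y 0)) \<in> G"
    have "analytic_in ?P {z \<in> topspace ?P. (q (col (snd z) 0), col (snd z) 1) \<notin> C}"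
    proof -
      have "continuous_map ?P (prod_topology V baire_space) (\<lambda>z. (q (col (snd z) 0), col (snd z) 1))"
        by (intro continuous_map_pairedI qcol col)
      from analytic_in_preimage[OF this Cco] show ?thesis
        by (rule back_subst[of "analytic_in ?P"]) (use q(2) in auto)
    qed
    moreover have "analytic_in ?P {z \<in> topspace ?P. (fst z, q (col (snd z) 0)) \<notin> G}"
    proof (rule analytic_in_Collect_openin(1)[OF mP])
      have "continuous_map ?P (prod_topology P V) (\<lambda>z. (fst z, q (col (snd z) 0)))"
        by (intro continuous_map_pairedI qcol continuous_map_fst)
      moreover have "openin (prod_topology P V) (topspace (prod_topology P V) - G)"
        using assms(4) by blast
      ultimately have "openin ?P {z \<in> topspace ?P. (fst z, q (col (snd z) 0)) \<in> topspace (prod_topology P V) - G}"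
        by (rule openin_continuous_map_preimage)
      then show "openin ?P {z \<in> topspace ?P. (fst z, q (col (snd z) 0)) \<notin> G}"
        by (rule back_subst[of "openin ?P"]) (use q(2) in auto)
    qed
    ultimately have "analytic_in ?P {z \<in> topspace ?P. \<not> ?\<phi> (fst z) (snd z)}"
      unfolding de_Morgan_conj by (rule analytic_in_Collect_disj)
    then have "sigma12_in P {p \<in> topspace P. \<exists>y. ?\<phi> p y}"
      by (rule sigma12_inI)
    moreover have "(\<exists>y. ?\<phi> p y) \<longleftrightarrow> (\<exists>K\<in>S. (p, K) \<in> G)" for p
    proof
      assume "\<exists>y. ?\<phi> p y"
      then obtain y where y: "(q (col y 0), col y 1) \<in> C" "(p, q (col y 0)) \<in> G" by blast
      from imageI[OF y(1), of fst] have "q (col y 0) \<in> S" by (simp add: C(2))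
      with y(2) show "\<exists>K\<in>S. (p, K) \<in> G" by blast
    next
      assume "\<exists>K\<in>S. (p, K) \<in> G"
      then obtain K z where K: "(K, z) \<in> C" "(p, K) \<in> G" using C(2) by auto
      then have "K \<in> range q" using Csub q(2) by auto
      then obtain y where "K = q y" by blast
      with K show "\<exists>y. ?\<phi> p y"
        by (intro exI[of _ "of_cols (\<lambda>n. if n = 0 then y else z)"]) simp
    qed
    ultimately show ?thesis by (simp only:)
  qed
qed

subsection \<open>The Vietoris topology\<close>

text \<open>The empty set is required to occur so that unions of sequences of members of the base include it.\<close>

definition base_sequence :: "'a topology \<Rightarrow> (nat \<Rightarrow> 'a set) \<Rightarrow> bool" where
  "base_sequence X B \<longleftrightarrow> (\<forall>n. openin X (B n)) \<and> {} \<in> range B \<and>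
    (\<forall>U x. openin X U \<and> x \<in> U \<longrightarrow> (\<exists>n. x \<in> B n \<and> B n \<subseteq> U))"

lemma base_sequence_openin: "base_sequence X B \<Longrightarrow> openin X (B n)"
  by (simp add: base_sequence_def)

lemma base_sequenceE:
  assumes "base_sequence X B" "openin X U" "x \<in> U"
  obtains n where "x \<in> B n" "B n \<subseteq> U"
  using assms unfolding base_sequence_def by metis

lemma second_countable_imp_base_sequence:
  assumes "second_countable X"
  shows "\<exists>B. base_sequence X B"
proof -
  obtain \<B> where B: "countable \<B>" "\<forall>V\<in>\<B>. openin X V"
    "\<forall>U x. openin X U \<and> x \<in> U \<longrightarrow> (\<exists>V\<in>\<B>. x \<in> V \<and> V \<subseteq> U)"
    using assms unfolding second_countable_def by blast
  have r: "range (from_nat_into (insert {} \<B>)) = insert {} \<B>"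
    using B(1) by (intro range_from_nat_into) auto
  have "openin X (from_nat_into (insert {} \<B>) n)" for n
    using from_nat_into[of "insert {} \<B>" n] B(2) by auto
  moreover have "\<exists>n. x \<in> from_nat_into (insert {} \<B>) n \<and> from_nat_into (insert {} \<B>) n \<subseteq> U"
    if U: "openin X U" "x \<in> U" for U x
  proof -
    obtain V where V: "V \<in> \<B>" "x \<in> V \<and> V \<subseteq> U" using B(3) U by blast
    then have "V \<in> range (from_nat_into (insert {} \<B>))" unfolding r by simp
    with V show ?thesis by auto
  qed
  ultimately show ?thesis
    unfolding base_sequence_def by (intro exI[of _ "from_nat_into (insert {} \<B>)"]) (simp add: r)
qed

text \<open>Finite nets of mesh \<open>1 / Suc n\<close> exist by total boundedness; the balls of
  these radii around the net points form a countable base.\<close>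

lemma second_countable_compact_metrizable:
  assumes "compact_space X" "metrizable_space X"
  shows "second_countable X"
proof -
  obtain M d where "Metric_space M d" and X: "X = Metric_space.mtopology M d"
    using assms(2) by (auto simp: metrizable_space_def)
  interpret Metric_space M d by fact
  have "mtotally_bounded M"
    using assms(1) X compact_space_eq_mcomplete_mtotally_bounded by simp
  then have "\<exists>K. finite K \<and> K \<subseteq> M \<and> M \<subseteq> (\<Union>x\<in>K. mball x (1 / Suc n))" for n
    by (simp add: mtotally_bounded_def)
  then obtain K where K: "\<And>n. finite (K n)" "\<And>n. K n \<subseteq> M"
    "\<And>n. M \<subseteq> (\<Union>x\<in>K n. mball x (1 / Suc n))" by metis
  let ?B = "\<Union>n. (\<lambda>x. mball x (1 / Suc n)) ` K n"
  show ?thesis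
    unfolding second_countable_def
  proof (intro exI[of _ ?B] conjI allI impI)
    show "countable ?B"
      using K(1) by (intro countable_UN countable_image) (auto intro: countable_finite)
    show "\<forall>V\<in>?B. openin X V" by (auto simp: X)
    fix U x assume Ux: "openin X U \<and> x \<in> U"
    then have "U \<subseteq> M" "\<exists>r>0. mball x r \<subseteq> U"
      unfolding X openin_mtopology by blast+
    with Ux obtain r where r: "r > 0" "mball x r \<subseteq> U" and xM: "x \<in> M" by blast
    obtain n where n: "1 / Suc n < r / 2"
      using r(1) reals_Archimedean[of "r/2"] by (auto simp: inverse_eq_divide)
    obtain c where c: "c \<in> K n" "x \<in> mball c (1 / Suc n)" using K(3)[of n] xM by auto
    have "mball c (1 / Suc n) \<subseteq> mball x r"
    proof
      fix z assume "z \<in> mball c (1 / Suc n)"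
      then show "z \<in> mball x r"
        using c n xM triangle[of x c z] commute[of x c] by auto
    qed
    with c r show "\<exists>V\<in>?B. x \<in> V \<and> V \<subseteq> U" by blast
  qed
qed

section \<open>Compactness and Polishness of the hyperspace\<close>

lemma openin_vietoris:
  assumes "openin Z U"
  shows "openin (vietoris Z) {K. compactin Z K \<and> K \<subseteq> U}"
    and "openin (vietoris Z) {K. compactin Z K \<and> K \<inter> U \<noteq> {}}"
  unfolding vietoris_def by (rule topology_generated_by_Basis, use assms in blast)+

text \<open>By Alexander's subbase theorem it suffices to find finite subcovers of covers by sets
  \<open>S U\<close> and \<open>H U\<close>.\<close>

lemma compact_space_vietoris:
  assumes "compact_space Z"
  shows "compact_space (vietoris Z)"
proof -
  define S where "S U = {K. compactin Z K \<and> K \<subseteq> U}" for U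
  define H where "H U = {K. compactin Z K \<and> K \<inter> U \<noteq> {}}" for U
  define B where "B = {S U | U. openin Z U} \<union> {H U | U. openin Z U}"
  define T where "T = {K. compactin Z K}"
  have B_cases: "(\<exists>U. openin Z U \<and> b = S U) \<or> (\<exists>U. openin Z U \<and> b = H U)" if "b \<in> B" for b
    using that unfolding B_def by blast
  have T: "T = S (topspace Z)"
    by (auto simp: T_def S_def dest: compactin_subset_topspace)
  have vie: "vietoris Z = topology_generated_by B"
    by (simp add: vietoris_def B_def S_def H_def)
  show ?thesis
  proof (rule Alexander_subbase_alt[of T B])
    have "S (topspace Z) \<in> B" unfolding B_def by blast
    then show "T \<subseteq> \<Union>B" by (subst T) (rule Union_upper)
  next
    fix C assume C: "C \<subseteq> B" "T \<subseteq> \<Union>C"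
    \<comment> \<open>The compact set \<open>topspace Z - W\<close> misses every \<open>U\<close> with \<open>H U \<in> C\<close>, so it lies in some \<open>S U \<in> C\<close>;
      then \<open>S U\<close> and the finitely many \<open>H U'\<close> for a finite subcover of \<open>topspace Z - U\<close> suffice.\<close>
    define W where "W = \<Union>{U. openin Z U \<and> H U \<in> C}"
    have W: "openin Z W" unfolding W_def by blast
    then have "compactin Z (topspace Z - W)"
      using closedin_compact_space[OF assms] by blast
    then have "topspace Z - W \<in> \<Union>C" by (intro subsetD[OF C(2)]) (simp add: T_def)
    then obtain c where c: "c \<in> C" "topspace Z - W \<in> c" by blast
    have "\<exists>U. openin Z U \<and> c = S U"
    proof (rule ccontr)
      \<comment> \<open>Otherwise \<open>c\<close> is some \<open>H U\<close> with \<open>U\<close>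
        contained in \<open>W\<close>, but then \<open>topspace Z - W\<close> does not meet
        \<open>U\<close>.\<close>
      assume "\<nexists>U. openin Z U \<and> c = S U"
      with c C(1) obtain U where U: "openin Z U" "c = H U" using B_cases by blast
      then have "U \<subseteq> W" using c by (auto simp: W_def)
      then show False using c U by (auto simp: H_def)
    qed
    then obtain U where U: "openin Z U" "c = S U" by blast
    have "topspace Z - U \<subseteq> \<Union>{U. openin Z U \<and> H U \<in> C}"
      using c U by (auto simp: W_def S_def)
    moreover have "compactin Z (topspace Z - U)"
      using closedin_compact_space[OF assms] U(1) by blast
    ultimately have "\<exists>F. finite F \<and> F \<subseteq> {U. openin Z U \<and> H U \<in> C} \<and> topspace Z - U \<subseteq> \<Union>F"
      by (intro compactinD) auto
    then obtain F where F: "finite F" "F \<subseteq> {U. openin Z U \<and> H U \<in> C}" "topspace Z - U \<subseteq> \<Union>F"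
      by blast
    show "\<exists>C'. finite C' \<and> C' \<subseteq> C \<and> T \<subseteq> \<Union>C'"
    proof (intro exI[of _ "insert c (H ` F)"] conjI)
      show "T \<subseteq> \<Union>(insert c (H ` F))"
      proof
        fix K assume K: "K \<in> T"
        show "K \<in> \<Union>(insert c (H ` F))"
        proof (cases "K \<subseteq> U")
          case False
          then obtain z where "z \<in> K" "z \<in> topspace Z - U"
            using K compactin_subset_topspace unfolding T_def by blast
          then show ?thesis using K F(3) by (auto simp: H_def T_def)
        qed (use K U in \<open>auto simp: S_def T_def\<close>)
      qed
    qed (use F c in auto)
  next
    \<comment> \<open>This is the form in which Alexander's theorem describes the topology. Members
      of \<open>B\<close> lie inside \<open>T\<close>, so relativizing to \<open>T\<close> leaves
      them unchanged, and each topology is the coarsest one containing them.\<close>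
    let ?X = "topology (arbitrary union_of (finite intersection_of (\<lambda>x. x \<in> B) relative_to T))"
    have "openin (vietoris Z) V" if "openin ?X V" for V
    proof (rule minimal_topology_subbase[OF _ _ that])
      show "openin (vietoris Z) b" if "b \<in> B" for b
        using that unfolding vie by (rule topology_generated_by_Basis)
      show "openin (vietoris Z) T"
        using openin_topspace[of "vietoris Z"] by (simp add: topspace_vietoris T_def)
    qed
    moreover have "openin ?X V" if "openin (vietoris Z) V" for V
    proof (rule generate_topology_on_coarsest[of _ B])
      show "istopology (openin ?X)" by simp
      show "generate_topology_on B V"
        using that by (simp add: vie openin_topology_generated_by_iff)
      fix b assume b: "b \<in> B"
      then have "(finite intersection_of (\<lambda>x. x \<in> B) relative_to T) (T \<inter> b)"
        by (simp add: relative_to_inc finite_intersection_of_inc)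
      moreover have "T \<inter> b = b"
        using B_cases[OF b] by (auto simp: S_def H_def T_def)
      ultimately show "openin ?X b"
        unfolding openin_subbase by (simp add: arbitrary_union_of_inc)
    qed
    ultimately show "?X = vietoris Z" by (metis topology_eq)
  qed
qed

text \<open>A continuous injection of the compact hyperspace into the space of real sequences is a
  homeomorphism onto its image. The image is compact, hence closed, hence Polish.\<close>

lemma polish_vietoris:
  assumes "compact_space Z" "metrizable_space Z"
  shows "polish (vietoris Z)"
proof -
  obtain M d where "Metric_space M d" and Z: "Z = Metric_space.mtopology M d"
    using assms(2) by (auto simp: metrizable_space_def)
  interpret Metric_space M d by fact
  obtain D where D: "countable D" "D \<subseteq> M" "mtopology closure_of D = M"
    using second_countable_imp_separable_space[OF second_countable_compact_metrizable[OF assms]] Z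
    by (auto simp: separable_space_def)
  define e where "e = from_nat_into D"
  have e: "e n \<in> M" if "M \<noteq> {}" for n
  proof -
    have "D \<noteq> {}" using that D(3) by auto
    then show ?thesis using from_nat_into[of D n] D(2) unfolding e_def by blast
  qed
  have e_dense: "\<exists>n. d p (e n) < r" if "p \<in> M" "r > 0" for p r
  proof -
    have "p \<in> mtopology closure_of D" using that D(3) by simp
    then have "\<exists>q\<in>D. q \<in> mball p r"
      using \<open>r > 0\<close> unfolding metric_closure_of by blast
    then obtain q where "q \<in> D" "d p q < r" by auto
    then show ?thesis
      using from_nat_into_surj[OF D(1)] by (auto simp: e_def)
  qed
  \<comment> \<open>Distances from a dense sequence, truncated at 1 so that the empty set is no exception,
    embed the hyperspace in \<open>nat \<Rightarrow> real\<close>.\<close>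
  define \<phi> where "\<phi> K n = Inf (insert 1 (d (e n) ` K))" for K n
  have bdd: "bdd_below (insert 1 (d (e n) ` K))" for K n
    by (rule bdd_belowI[of _ 0]) auto
  have less: "\<phi> K n < a \<longleftrightarrow> 1 < a \<or> (\<exists>y\<in>K. d (e n) y < a)" for K n a
    unfolding \<phi>_def by (subst cInf_less_iff[OF _ bdd]) auto
  have ge: "a \<le> \<phi> K n \<longleftrightarrow> a \<le> 1 \<and> (\<forall>y\<in>K. a \<le> d (e n) y)" for K n a
    using less[of K n a] by (auto simp: not_less)
  have sub: "K \<subseteq> M" if "compactin Z K" for K
    using compactin_subset_topspace[OF that] Z by simp
  have op1: "openin Z {y \<in> M. d (e n) y < a}" for n a
  proof (cases "M = {}")
    case False
    then have "{y \<in> M. d (e n) y < a} = mball (e n) a" using e by auto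
    then show ?thesis by (simp add: Z)
  qed simp
  have op2: "openin Z {y \<in> M. a < d (e n) y}" for n a
  proof (cases "M = {}")
    case False
    then have "{y \<in> M. a < d (e n) y} = M - mcball (e n) a" using e by auto
    then show ?thesis using closedin_mcball[of "e n" a] by (simp add: Z closedin_def)
  qed simp
  have cont: "continuous_map (vietoris Z) euclidean \<phi>"
  proof -
    have "continuous_map (vietoris Z) euclideanreal (\<lambda>K. \<phi> K n)" for n
      unfolding continuous_map_upper_lower_semicontinuous_lt
    proof (intro conjI allI)
      fix a
      have "\<phi> K n < a \<longleftrightarrow> 1 < a \<or> K \<inter> {y \<in> M. d (e n) y < a} \<noteq> {}" if "compactin Z K" for K
        using less sub[OF that] by blast
      then have "{K \<in> topspace (vietoris Z). \<phi> K n < a} =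
          (if 1 < a then topspace (vietoris Z) else {K. compactin Z K \<and> K \<inter> {y \<in> M. d (e n) y < a} \<noteq> {}})"
        by (auto simp: topspace_vietoris)
      then show "openin (vietoris Z) {K \<in> topspace (vietoris Z). \<phi> K n < a}"
        using openin_vietoris(2)[OF op1] by simp
      \<comment> \<open>The intermediate bound \<open>b\<close> avoids arguing that the infimum is
        attained; \<open>b < 1\<close> reflects the truncation.\<close>
      have "a < \<phi> K n \<longleftrightarrow> (\<exists>b\<in>{a<..<1}. K \<subseteq> {y \<in> M. b < d (e n) y})" if "compactin Z K" for K
      proof
        assume "a < \<phi> K n"
        then obtain b where b: "a < b" "b < \<phi> K n" using dense by blast
        then have "K \<subseteq> {y \<in> M. b < d (e n) y}" "b < 1"
          using ge[of "\<phi> K n" K n] sub[OF that] by fastforce+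
        with b show "\<exists>b\<in>{a<..<1}. K \<subseteq> {y \<in> M. b < d (e n) y}" by auto
      next
        assume "\<exists>b\<in>{a<..<1}. K \<subseteq> {y \<in> M. b < d (e n) y}"
        then obtain b where b: "a < b" "b < 1" "K \<subseteq> {y \<in> M. b < d (e n) y}" by auto
        then have "b \<le> \<phi> K n" using ge[of b K n] by fastforce
        with b show "a < \<phi> K n" by simp
      qed
      then have "{K \<in> topspace (vietoris Z). a < \<phi> K n} =
          (\<Union>b\<in>{a<..<1}. {K. compactin Z K \<and> K \<subseteq> {y \<in> M. b < d (e n) y}})"
        by (auto simp: topspace_vietoris)
      then show "openin (vietoris Z) {K \<in> topspace (vietoris Z). a < \<phi> K n}"
        using openin_vietoris(1)[OF op2] by auto
    qed
    then have "continuous_map (vietoris Z) (product_topology (\<lambda>_. euclideanreal) UNIV) \<phi>"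
      by (simp only: continuous_map_componentwise_UNIV) simp
    then show ?thesis by (simp only: euclidean_product_topology)
  qed
  have ne: "\<phi> K \<noteq> \<phi> L" if K: "compactin Z K" and L: "compactin Z L" and y: "y \<in> L" "y \<notin> K" for K L y
  proof -
    have yM: "y \<in> M" using sub[OF L] y by auto
    have "closedin Z K"
      using K by (intro compactin_imp_closedin) (simp_all add: Z Hausdorff_space_mtopology)
    then have "openin Z (M - K)" by (simp add: Z closedin_def)
    then obtain r0 where r0: "r0 > 0" "mball y r0 \<subseteq> M - K"
      using yM y by (auto simp: Z openin_mtopology)
    \<comment> \<open>The minimum with 1 keeps the lower bound \<open>r/2\<close> for
      \<open>K\<close> valid despite the truncation. A dense point within \<open>r/2\<close> of
      \<open>y\<close> then distinguishes \<open>L\<close> from \<open>K\<close>.\<close>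
    define r where "r = min r0 1"
    have r: "r > 0" "r \<le> 1" "\<And>z. z \<in> K \<Longrightarrow> r \<le> d y z"
    proof -
      show "r > 0" "r \<le> 1" using r0 by (auto simp: r_def)
      fix z assume "z \<in> K"
      then have "z \<notin> mball y r0" "z \<in> M" using r0 sub[OF K] by auto
      then show "r \<le> d y z" using yM by (auto simp: r_def)
    qed
    obtain n where n: "d y (e n) < r/2" using e_dense[OF yM, of "r/2"] r by auto
    have eM: "e n \<in> M" using e yM by blast
    have "\<phi> L n < r/2" using less[of L n "r/2"] n y by (auto simp: commute)
    moreover have "r/2 \<le> d (e n) z" if "z \<in> K" for z
      using triangle[OF yM eM, of z] sub[OF K] that r(3)[OF that] n by auto
    then have "r/2 \<le> \<phi> K n" using ge[of "r/2" K n] r by auto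
    ultimately show ?thesis by auto
  qed
  have inj: "inj_on \<phi> (topspace (vietoris Z))"
    by (rule inj_onI) (metis ne mem_Collect_eq topspace_vietoris subsetI subset_antisym)
  let ?I = "\<phi> ` topspace (vietoris Z)"
  have "compactin euclidean ?I"
    using image_compactin[OF _ cont] compact_space_vietoris[OF assms(1)]
    by (simp add: compact_space_def)
  then have "closedin euclidean ?I"
    by (simp add: compact_imp_closed)
  then have pol: "polish (subtopology euclidean ?I)"
    by (intro polish_closedin completely_metrizable_space_euclidean second_countable_euclidean)
  have "homeomorphic_map (vietoris Z) (subtopology euclidean ?I) \<phi>"
  proof (rule continuous_imp_homeomorphic_map)
    show "continuous_map (vietoris Z) (subtopology euclidean ?I) \<phi>"
      using cont by (simp add: continuous_map_in_subtopology)
    show "Hausdorff_space (subtopology euclidean ?I)"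
      by (simp add: Hausdorff_space_subtopology)
  qed (use inj compact_space_vietoris[OF assms(1)] in auto)
  then have "vietoris Z homeomorphic_space subtopology euclidean ?I"
    by (rule homeomorphic_map_imp_homeomorphic_space)
  with pol show ?thesis
    unfolding polish_def
    using homeomorphic_completely_metrizable_space homeomorphic_separable_space by blast
qed

text \<open>Disjoint neighbourhoods of a compact set and of a point outside it give a product
  neighbourhood on which non-membership persists.\<close>

lemma openin_vietoris_notin:
  assumes "compact_space Z" "Hausdorff_space Z"
  shows "openin (prod_topology (vietoris Z) Z) {z \<in> topspace (prod_topology (vietoris Z) Z). snd z \<notin> fst z}"
    (is "openin ?P ?A")
proof (subst openin_subopen, intro ballI)
  fix z assume "z \<in> ?A"
  then have K: "compactin Z (fst z)" and x: "snd z \<in> topspace Z" "snd z \<notin> fst z"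
    by (auto simp: topspace_vietoris)
  have "compactin Z {snd z}" "disjnt (fst z) {snd z}"
    using x by auto
  then obtain U W where UW: "openin Z U" "openin Z W" "fst z \<subseteq> U" "{snd z} \<subseteq> W" "disjnt U W"
    using assms(2) K unfolding Hausdorff_space_compact_sets by meson
  let ?T = "{K. compactin Z K \<and> K \<subseteq> U} \<times> W"
  have "openin ?P ?T"
    using openin_vietoris(1)[OF UW(1)] UW(2) by (simp add: openin_prod_Times_iff)
  moreover have "z \<in> ?T" using K UW by (auto simp: mem_Times_iff)
  moreover have "?T \<subseteq> ?A"
    using UW(5) openin_subset[OF UW(2)] by (auto simp: topspace_vietoris disjnt_iff)
  ultimately show "\<exists>T. openin ?P T \<and> z \<in> T \<and> T \<subseteq> ?A" by blast
qed

lemma openin_Collect_notin_vietoris: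
  assumes "compact_space Z" "Hausdorff_space Z"
    and "continuous_map P (vietoris Z) h" "continuous_map P Z g"
  shows "openin P {p \<in> topspace P. g p \<notin> h p}"
proof -
  have c: "continuous_map P (prod_topology (vietoris Z) Z) (\<lambda>p. (h p, g p))"
    by (intro continuous_map_pairedI assms)
  from openin_continuous_map_preimage[OF c openin_vietoris_notin[OF assms(1,2)]]
  show ?thesis
    by (rule back_subst[of "openin P"]) (use continuous_map_funspace[OF c] in auto)
qed

subsection \<open>Zero-dimensional closed sets\<close>

text \<open>Every point of the Baire space is a legitimate code, so quantifying over open sets needs
  no side condition on codes.\<close>

definition coded_open :: "(nat \<Rightarrow> 'a set) \<Rightarrow> (nat \<Rightarrow> nat) \<Rightarrow> 'a set" where
  "coded_open B a = (\<Union>k. B (a k))"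

lemma openin_coded_open: "base_sequence Z B \<Longrightarrow> openin Z (coded_open B a)"
  by (auto simp: coded_open_def base_sequence_openin)

lemma openin_imp_coded_open:
  assumes "base_sequence Z B" "openin Z U"
  shows "\<exists>a. U = coded_open B a"
proof -
  let ?N = "{n. B n \<subseteq> U}"
  have "?N \<noteq> {}" using assms(1) by (auto simp: base_sequence_def)
  then have "range (from_nat_into ?N) = ?N" by simp
  then have "coded_open B (from_nat_into ?N) = \<Union> (B ` ?N)"
    unfolding coded_open_def by (metis image_image)
  also have "\<dots> = U" using assms unfolding base_sequence_def by fast
  finally show ?thesis by metis
qed

text \<open>Membership is open jointly in point and code, since one entry of the code and one basic
  set already certify it.\<close>

lemma openin_Collect_coded_open:
  assumes "base_sequence Z B" "continuous_map P Z g" "continuous_map P baire_space h"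
  shows "openin P {p \<in> topspace P. g p \<in> coded_open B (h p)}"
proof -
  have "openin P ({p \<in> topspace P. h p k = n} \<inter> {p \<in> topspace P. g p \<in> B n})" for k n
    using continuous_map_baire_coord[OF assms(3), of k] openin_continuous_map_preimage[OF assms(2) base_sequence_openin[OF assms(1)]]
    by (auto simp: continuous_map_into_discrete)
  then have "openin P (\<Union>k n. {p \<in> topspace P. h p k = n} \<inter> {p \<in> topspace P. g p \<in> B n})"
    by blast
  then show ?thesis
    by (rule back_subst[of "openin P"]) (auto simp: coded_open_def)
qed

text \<open>If this holds at all points of \<open>F\<close>, then \<open>F \<inter> U m j\<close> and \<open>F \<inter> V m j\<close> are complementary clopen
  subsets of \<open>F\<close>, and \<open>F \<inter> B m\<close> is the union of the \<open>F \<inter> U m j\<close>.\<close>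

definition splits_at :: "(nat \<Rightarrow> 'a set) \<Rightarrow> (nat \<Rightarrow> nat \<Rightarrow> 'a set) \<Rightarrow> (nat \<Rightarrow> nat \<Rightarrow> 'a set) \<Rightarrow> 'a \<Rightarrow> bool" where
  "splits_at B U V x \<longleftrightarrow>
    (\<forall>m. (x \<in> B m \<longleftrightarrow> (\<exists>j. x \<in> U m j)) \<and> (\<forall>j. x \<in> U m j \<longleftrightarrow> x \<notin> V m j))"

text \<open>From left to right an arbitrary clopen base must be thinned out to a family indexed by
  pairs of numbers; the second index runs over the basic sets \<open>B j\<close>. Conversely the
  pieces \<open>F \<inter> U m j\<close> are clopen and form a base of \<open>F\<close>.\<close>

lemma zero_dimensional_iff_splits_at:
  assumes B: "base_sequence Z B" and F: "F \<subseteq> topspace Z"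
  shows "zero_dimensional (subtopology Z F) \<longleftrightarrow>
    (\<exists>U V. (\<forall>m j. openin Z (U m j) \<and> openin Z (V m j)) \<and> (\<forall>x\<in>F. splits_at B U V x))"
proof
  assume "zero_dimensional (subtopology Z F)"
  then obtain \<B> where clopen: "\<And>W. W \<in> \<B> \<Longrightarrow> openin (subtopology Z F) W \<and> closedin (subtopology Z F) W"
    and base: "\<And>W x. openin (subtopology Z F) W \<Longrightarrow> x \<in> W \<Longrightarrow> \<exists>V\<in>\<B>. x \<in> V \<and> V \<subseteq> W"
    unfolding zero_dimensional_def openin_topology_base_unique by meson
  have topF: "topspace (subtopology Z F) = F" using F by auto
  \<comment> \<open>For each pair \<open>m\<close>, \<open>j\<close>, one clopen set between
    \<open>F \<inter> B j\<close> and \<open>B m\<close> is picked if the base has one. If not, the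
    default pair \<open>{}\<close>, \<open>topspace Z\<close> contributes nothing to the
    union.\<close>
  have "\<exists>U V. openin Z U \<and> openin Z V \<and> F \<inter> V = F - U \<and> F \<inter> U \<subseteq> B m \<and>
      ((\<exists>W\<in>\<B>. F \<inter> B j \<subseteq> W \<and> W \<subseteq> B m) \<longrightarrow> F \<inter> B j \<subseteq> U)" for m j
  proof (cases "\<exists>W\<in>\<B>. F \<inter> B j \<subseteq> W \<and> W \<subseteq> B m")
    case True
    then obtain W where W: "W \<in> \<B>" "F \<inter> B j \<subseteq> W" "W \<subseteq> B m" by blast
    have "openin (subtopology Z F) W" "openin (subtopology Z F) (F - W)"
      using clopen[OF W(1)] topF by (auto simp: closedin_def)
    then obtain U V where "openin Z U" "W = U \<inter> F" "openin Z V" "F - W = V \<inter> F"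
      by (auto simp: openin_subtopology)
    moreover from this have "F \<inter> V = F - U" by blast
    ultimately show ?thesis
      using W(2,3) by (intro exI[of _ U] exI[of _ V] conjI impI) auto
  next
    case False
    with F show ?thesis
      by (intro exI[of _ "{}"] exI[of _ "topspace Z"] conjI impI) (auto simp del: ex_simps)
  qed
  then obtain U V where UV: "\<And>m j. openin Z (U m j)" "\<And>m j. openin Z (V m j)"
    "\<And>m j. F \<inter> V m j = F - U m j" "\<And>m j. F \<inter> U m j \<subseteq> B m"
    "\<And>m j. \<exists>W\<in>\<B>. F \<inter> B j \<subseteq> W \<and> W \<subseteq> B m \<Longrightarrow> F \<inter> B j \<subseteq> U m j"
    by metis
  have "\<exists>j. x \<in> U m j" if x: "x \<in> F" "x \<in> B m" for x m
  proof -
    have "openin (subtopology Z F) (F \<inter> B m)"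
      using base_sequence_openin[OF B] by (rule openin_subtopology_Int2)
    then obtain W where W: "W \<in> \<B>" "x \<in> W" "W \<subseteq> F \<inter> B m" using base[of "F \<inter> B m" x] x by blast
    then obtain W' where W': "openin Z W'" "W = W' \<inter> F" using clopen[OF W(1)] by (auto simp: openin_subtopology)
    with W(2) obtain j where j: "x \<in> B j" "B j \<subseteq> W'" using base_sequenceE[OF B W'(1)] by blast
    then have "F \<inter> B j \<subseteq> U m j" using W W' by (intro UV(5) bexI[of _ W]) auto
    with j x have "x \<in> U m j" by blast
    then show ?thesis by blast
  qed
  then have "\<forall>x\<in>F. splits_at B U V x"
    using UV(3,4) unfolding splits_at_def by blast
  with UV(1,2) show "\<exists>U V. (\<forall>m j. openin Z (U m j) \<and> openin Z (V m j)) \<and> (\<forall>x\<in>F. splits_at B U V x)"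
    by blast
next
  assume "\<exists>U V. (\<forall>m j. openin Z (U m j) \<and> openin Z (V m j)) \<and> (\<forall>x\<in>F. splits_at B U V x)"
  then obtain U V where UV: "\<And>m j. openin Z (U m j)" "\<And>m j. openin Z (V m j)"
    and sp: "\<And>x. x \<in> F \<Longrightarrow> splits_at B U V x" by blast
  have topF: "topspace (subtopology Z F) = F" using F by auto
  let ?clopen = "\<lambda>W. openin (subtopology Z F) W \<and> closedin (subtopology Z F) W"
  have base: "\<exists>W'. ?clopen W' \<and> x \<in> W' \<and> W' \<subseteq> W" if W: "openin (subtopology Z F) W" "x \<in> W" for W x
  proof -
    obtain T where T: "openin Z T" "W = T \<inter> F" using W by (auto simp: openin_subtopology)
    with W(2) obtain m where m: "x \<in> B m" "B m \<subseteq> T" using base_sequenceE[OF B T(1)] by blast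
    have x: "x \<in> F" using W T by blast
    obtain j where j: "x \<in> U m j" using sp[OF x] m(1) by (auto simp: splits_at_def)
    have "F \<inter> U m j \<subseteq> B m" using sp by (auto simp: splits_at_def)
    moreover have "F - F \<inter> U m j = F \<inter> V m j" using sp by (auto simp: splits_at_def)
    then have "?clopen (F \<inter> U m j)"
      unfolding closedin_def topF
      using UV[of m j] openin_subtopology_Int2[of Z _ F] by auto
    ultimately show ?thesis using x j m T by (intro exI[of _ "F \<inter> U m j"]) blast
  qed
  have eq: "openin (subtopology Z F) = arbitrary union_of (\<lambda>W. W \<in> {W. ?clopen W})"
  proof (rule openin_topology_base_unique[THEN iffD2], intro conjI allI impI)
    fix W x assume "openin (subtopology Z F) W \<and> x \<in> W"
    then show "\<exists>V. V \<in> {W. ?clopen W} \<and> x \<in> V \<and> V \<subseteq> W"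
      unfolding mem_Collect_eq by (intro base) auto
  qed simp
  show "zero_dimensional (subtopology Z F)"
    unfolding zero_dimensional_def
  proof (intro exI conjI ballI)
    fix W assume "W \<in> {W. ?clopen W}"
    then show "openin (subtopology Z F) W" "closedin (subtopology Z F) W" by blast+
  qed (rule eq)
qed

section \<open>Complexity of the family of closures\<close>

lemma sigma12_in_closures_zero_dim_closed_sets:
  fixes X Z :: "'a topology"
  assumes X: "analytic_space TYPE('p) X" and Z: "compact_space Z" "metrizable_space Z"
    and sub: "topspace X \<subseteq> topspace Z" "X = subtopology Z (topspace X)"
  shows "sigma12_in (vietoris Z) ((\<lambda>F. Z closure_of F) ` zero_dim_closed_sets X)"
proof -
  let ?V = "vietoris Z"
  let ?P = "prod_topology ?V baire_space"
  have haus: "Hausdorff_space Z" using Z(2) by (rule metrizable_imp_Hausdorff_space)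
  have mV: "metrizable_space ?V"
    using polish_vietoris[OF Z] by (simp add: polish_def completely_metrizable_imp_metrizable_space)
  have mP: "metrizable_space ?P" using mV by (rule metrizable_prod_baire)
  obtain B where B: "base_sequence Z B"
    using second_countable_imp_base_sequence[OF second_countable_compact_metrizable[OF Z]] by blast
  have subF: "subtopology X F = subtopology Z F" if "F \<subseteq> topspace X" for F
    using that sub(2) by (metis inf.absorb2 subtopology_subtopology)
  have zdc: "zero_dim_closed_sets X = {F. closedin X F \<and> zero_dimensional (subtopology Z F)}"
    unfolding zero_dim_closed_sets_def closed_sets_def mem_Collect_eq
    by (rule Collect_cong) (metis closedin_subset subF)
  show ?thesis
  proof (cases "topspace X = {}")
    \<comment> \<open>There is no surjection from the Baire space here; the family consists of
      \<open>{}\<close> alone, which is singled out by the open condition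
      \<open>K \<subseteq> {}\<close>.\<close>
    case True
    have "zero_dimensional (subtopology Z {})"
      by (subst zero_dimensional_iff_splits_at[OF B]) (simp_all, intro exI[of _ "\<lambda>_ _. {}"], simp)
    moreover have "closedin X F \<longleftrightarrow> F = {}" for F
    proof
      assume "closedin X F"
      then have "F \<subseteq> topspace X" by (rule closedin_subset)
      with True show "F = {}" by blast
    qed simp
    ultimately have "zero_dim_closed_sets X = {{}}"
      unfolding zdc by (simp cong: conj_cong)
    moreover have "openin ?P {z \<in> topspace ?P. fst z \<in> {K. compactin Z K \<and> K \<subseteq> {}}}"
      by (intro openin_continuous_map_preimage[OF continuous_map_fst] openin_vietoris) simp
    then have "analytic_in ?P {z \<in> topspace ?P. \<not> (fst z \<in> {K. compactin Z K \<and> K \<subseteq> {}})}"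
      by (rule analytic_in_Collect_openin(2)[OF mP])
    then have "sigma12_in ?V {K \<in> topspace ?V. \<exists>y::nat \<Rightarrow> nat. K \<in> {K. compactin Z K \<and> K \<subseteq> {}}}"
      by (rule sigma12_inI)
    then have "sigma12_in ?V {{}}"
      by (rule back_subst[of "sigma12_in ?V"]) (auto simp: topspace_vietoris)
    ultimately show ?thesis by simp
  next
    case False
    then obtain f where fX: "continuous_map baire_space X f" and f: "range f = topspace X"
      using analytic_space_continuous_surjection[OF X] by blast
    have fZ: "continuous_map baire_space Z f"
      using fX sub(2) continuous_map_in_subtopology by metis
    \<comment> \<open>Layout of a code \<open>a\<close>: column 0 holds, for each \<open>m\<close>
      and \<open>j\<close>, codes of the two open sets \<open>U a m j\<close> and
      \<open>V a m j\<close>; column 1 holds parameters of a sequence \<open>g a\<close> in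
      \<open>topspace X\<close>.\<close>
    define U where "U a m j = coded_open B (col (col (col (col a 0) m) j) 0)" for a m j
    define V where "V a m j = coded_open B (col (col (col (col a 0) m) j) 1)" for a m j
    define g where "g a n = f (col (col a 1) n)" for a n
    \<comment> \<open>Points are tested through their parameters \<open>c\<close>, so only
      \<open>K \<inter> topspace X\<close> is examined. The next condition makes the points of
      \<open>g a\<close> lying in \<open>K\<close> dense in \<open>K\<close>; where \<open>K\<close>
      misses \<open>B n\<close>, the value \<open>g a n\<close> is free.\<close>
    let ?zd = "\<lambda>K a. \<forall>c. f c \<in> K \<longrightarrow> splits_at B (U a) (V a) (f c)"
    let ?dense = "\<lambda>K a. \<forall>n. K \<inter> B n = {} \<or> (g a n \<in> K \<and> g a n \<in> B n)"
    have "(\<lambda>F. Z closure_of F) ` zero_dim_closed_sets X = {K \<in> topspace ?V. \<exists>a. ?zd K a \<and> ?dense K a}"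
    proof (intro equalityI subsetI)
      fix K assume "K \<in> (\<lambda>F. Z closure_of F) ` zero_dim_closed_sets X"
      then obtain F where K: "K = Z closure_of F" and F: "closedin X F" "zero_dimensional (subtopology Z F)"
        by (auto simp: zdc)
      have FX: "F \<subseteq> topspace X" using F(1) by (rule closedin_subset)
      \<comment> \<open>As \<open>F\<close> is closed in \<open>X\<close>, it can be recovered from
        its closure in \<open>Z\<close>.\<close>
      have KX: "K \<inter> topspace X = F"
      proof -
        have "F = X closure_of F" using F(1) by (simp add: closure_of_closedin)
        also have "\<dots> = topspace X \<inter> K"
          using FX sub(2) by (metis K closure_of_subtopology inf.absorb_iff2)
        finally show ?thesis by blast
      qed
      have "F \<subseteq> topspace Z" using FX sub(1) by blast
      from F(2)[unfolded zero_dimensional_iff_splits_at[OF B this]]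
      obtain U' V' where UV: "\<forall>m j. openin Z (U' m j) \<and> openin Z (V' m j)"
        "\<forall>x\<in>F. splits_at B U' V' x" by blast
      have "\<forall>m j. \<exists>u. U' m j = coded_open B u" "\<forall>m j. \<exists>v. V' m j = coded_open B v"
        using UV(1) openin_imp_coded_open[OF B] by simp_all
      then obtain u v where uv: "\<forall>m j. U' m j = coded_open B (u m j)"
        "\<forall>m j. V' m j = coded_open B (v m j)" by metis
      have "\<exists>y. K \<inter> B n = {} \<or> f y \<in> K \<and> f y \<in> B n" for n
      proof (cases "K \<inter> B n = {}")
        case False
        then have "F \<inter> B n \<noteq> {}"
          using openin_Int_closure_of_eq_empty[OF base_sequence_openin[OF B], of n F] K by blast
        then obtain x where "x \<in> F" "x \<in> B n" by blast
        moreover then obtain y where "x = f y" using f FX by blast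
        ultimately show ?thesis using KX by blast
      qed simp
      then obtain y where y: "\<forall>n. K \<inter> B n = {} \<or> f (y n) \<in> K \<and> f (y n) \<in> B n" by metis
      define a where "a = of_cols (\<lambda>i. if i = 0
        then of_cols (\<lambda>m. of_cols (\<lambda>j. of_cols (\<lambda>i. if i = 0 then u m j else v m j)))
        else of_cols y)"
      have "U a = U'" "V a = V'" "g a n = f (y n)" for n
        by (simp_all add: U_def V_def g_def a_def uv fun_eq_iff)
      moreover have "f c \<in> F" if "f c \<in> K" for c
        using that KX f by auto
      ultimately have "?zd K a \<and> ?dense K a"
        using UV(2) y by simp
      moreover have "K \<in> topspace ?V"
        using Z(1) by (simp add: K topspace_vietoris closedin_compact_space)
      ultimately show "K \<in> {K \<in> topspace ?V. \<exists>a. ?zd K a \<and> ?dense K a}" by blast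
    next
      fix K assume "K \<in> {K \<in> topspace ?V. \<exists>a. ?zd K a \<and> ?dense K a}"
      then obtain a where K: "compactin Z K" and a: "?zd K a" "?dense K a"
        by (auto simp: topspace_vietoris)
      have clK: "closedin Z K" using haus K by (rule compactin_imp_closedin)
      let ?F = "K \<inter> topspace X"
      have "closedin X ?F"
        by (subst sub(2), subst closedin_subtopology) (use clK in blast)
      moreover have "zero_dimensional (subtopology Z ?F)"
      proof (subst zero_dimensional_iff_splits_at[OF B])
        show "?F \<subseteq> topspace Z" using sub(1) by blast
        have "splits_at B (U a) (V a) x" if "x \<in> ?F" for x
        proof -
          have "x \<in> range f" using that f by blast
          then show ?thesis using a(1) that by blast
        qed
        moreover have "openin Z (U a m j)" "openin Z (V a m j)" for m j
          by (simp_all add: U_def V_def openin_coded_open[OF B])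
        ultimately show "\<exists>U V. (\<forall>m j. openin Z (U m j) \<and> openin Z (V m j)) \<and> (\<forall>x\<in>?F. splits_at B U V x)"
          by blast
      qed
      moreover have "Z closure_of ?F = K"
      proof
        show "Z closure_of ?F \<subseteq> K" using clK by (intro closure_of_minimal) auto
        show "K \<subseteq> Z closure_of ?F"
        proof
          fix x assume x: "x \<in> K"
          have "\<exists>y\<in>?F. y \<in> T" if T: "x \<in> T" "openin Z T" for T
          proof -
            obtain n where n: "x \<in> B n" "B n \<subseteq> T" using base_sequenceE[OF B T(2,1)] by blast
            then have "g a n \<in> K" "g a n \<in> B n" using a(2) x by blast+
            moreover have "g a n \<in> topspace X" using f by (auto simp: g_def)
            ultimately show ?thesis using n by blast
          qed
          then show "x \<in> Z closure_of ?F"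
            using x compactin_subset_topspace[OF K] by (auto simp: in_closure_of)
        qed
      qed
      ultimately show "K \<in> (\<lambda>F. Z closure_of F) ` zero_dim_closed_sets X"
        by (intro image_eqI[of _ _ ?F]) (auto simp: zdc)
    qed
    moreover have "sigma12_in ?V {K \<in> topspace ?V. \<exists>a. ?zd K a \<and> ?dense K a}"
    proof (rule sigma12_inI[where \<phi> = "\<lambda>K a. ?zd K a \<and> ?dense K a"])
      \<comment> \<open>Points of \<open>?Q\<close> are triples \<open>((K, a), c)\<close>. The
        negation of \<open>?zd\<close> is existential in \<open>c\<close>: its matrix is shown
        analytic over \<open>?Q\<close> and then projected to \<open>?P\<close>.\<close>
      let ?Q = "prod_topology ?P baire_space"
      have mQ: "metrizable_space ?Q" using mP by (rule metrizable_prod_baire)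
      \<comment> \<open>Facts 1 and 2 are the open and the negated case over \<open>?Q\<close>,
        facts 3 and 4 those over \<open>?P\<close>.\<close>
      note open_or_closed = analytic_in_Collect_openin[OF mQ] analytic_in_Collect_openin[OF mP]
      have QV: "continuous_map ?Q ?V (\<lambda>z. fst (fst z))"
        using continuous_map_compose[OF continuous_map_fst continuous_map_fst] by (simp add: o_def)
      have Qa: "continuous_map ?Q baire_space (\<lambda>z. snd (fst z))"
        using continuous_map_compose[OF continuous_map_fst continuous_map_snd] by (simp add: o_def)
      have Qf: "continuous_map ?Q Z (\<lambda>z. f (snd z))"
        using continuous_map_compose[OF continuous_map_snd fZ] by (simp add: o_def)
      have Pg: "continuous_map ?P Z (\<lambda>z. g (snd z) n)" for n
        using continuous_map_compose[OF continuous_map_col[OF continuous_map_col[OF continuous_map_snd]] fZ]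
        by (simp add: o_def g_def)
      have opU: "openin ?Q {z \<in> topspace ?Q. f (snd z) \<in> U (snd (fst z)) m j}"
        and opV: "openin ?Q {z \<in> topspace ?Q. f (snd z) \<in> V (snd (fst z)) m j}" for m j
        unfolding U_def V_def by (intro openin_Collect_coded_open[OF B Qf] continuous_map_col Qa)+
      have opB: "openin ?Q {z \<in> topspace ?Q. f (snd z) \<in> B m}" for m
        by (rule openin_continuous_map_preimage[OF Qf base_sequence_openin[OF B]])
      have opK: "openin ?Q {z \<in> topspace ?Q. f (snd z) \<notin> fst (fst z)}"
        by (rule openin_Collect_notin_vietoris[OF Z(1) haus QV Qf])
      have "analytic_in ?Q {z \<in> topspace ?Q. f (snd z) \<in> fst (fst z) \<and>
          \<not> splits_at B (U (snd (fst z))) (V (snd (fst z))) (f (snd z))}"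
      proof -
        have xor: "\<not> (\<alpha> \<longleftrightarrow> \<beta>) \<longleftrightarrow> \<alpha> \<and> \<not> \<beta> \<or> \<not> \<alpha> \<and> \<beta>" for \<alpha> \<beta>
          by blast
        have not_splits_at: "\<not> splits_at B U V x \<longleftrightarrow>
            (\<exists>m. (x \<in> B m \<and> (\<forall>j. x \<notin> U m j)) \<or> (x \<notin> B m \<and> (\<exists>j. x \<in> U m j)) \<or>
              (\<exists>j. (x \<in> U m j \<and> x \<in> V m j) \<or> (x \<notin> U m j \<and> x \<notin> V m j)))" for U V x
          by (simp only: splits_at_def not_all de_Morgan_conj xor not_ex not_not disj_assoc)
        have K: "analytic_in ?Q {z \<in> topspace ?Q. f (snd z) \<in> fst (fst z)}"
          using open_or_closed(2)[OF opK] by simp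
        show ?thesis
          unfolding not_splits_at
        proof (rule analytic_in_Collect_conj[OF K], intro analytic_in_Collect_ex_nat analytic_in_Collect_disj)
          fix m
          show "analytic_in ?Q {z \<in> topspace ?Q. f (snd z) \<in> B m \<and> (\<forall>j. f (snd z) \<notin> U (snd (fst z)) m j)}"
            by (rule analytic_in_Collect_conj, rule open_or_closed(1)[OF opB])
              (rule analytic_in_Collect_all_nat, rule open_or_closed(2)[OF opU])
          show "analytic_in ?Q {z \<in> topspace ?Q. f (snd z) \<notin> B m \<and> (\<exists>j. f (snd z) \<in> U (snd (fst z)) m j)}"
            by (rule analytic_in_Collect_conj, rule open_or_closed(2)[OF opB])
              (rule analytic_in_Collect_ex_nat, rule open_or_closed(1)[OF opU])
          fix j
          show "analytic_in ?Q {z \<in> topspace ?Q. f (snd z) \<in> U (snd (fst z)) m j \<and> f (snd z) \<in> V (snd (fst z)) m j}"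
            by (rule analytic_in_Collect_conj[OF open_or_closed(1)[OF opU] open_or_closed(1)[OF opV]])
          show "analytic_in ?Q {z \<in> topspace ?Q. f (snd z) \<notin> U (snd (fst z)) m j \<and> f (snd z) \<notin> V (snd (fst z)) m j}"
            by (rule analytic_in_Collect_conj[OF open_or_closed(2)[OF opU] open_or_closed(2)[OF opV]])
        qed
      qed
      then have "analytic_in ?P {z \<in> topspace ?P. \<exists>c. f c \<in> fst z \<and> \<not> splits_at B (U (snd z)) (V (snd z)) (f c)}"
        by (rule analytic_in_Collect_ex_baire)
      moreover have "analytic_in ?P {z \<in> topspace ?P. \<exists>n. fst z \<inter> B n \<noteq> {} \<and>
          (g (snd z) n \<notin> fst z \<or> g (snd z) n \<notin> B n)}"
      proof (intro analytic_in_Collect_ex_nat analytic_in_Collect_conj analytic_in_Collect_disj)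
        fix n
        have "openin ?P {z \<in> topspace ?P. fst z \<in> {K. compactin Z K \<and> K \<inter> B n \<noteq> {}}}"
          by (intro openin_continuous_map_preimage[OF continuous_map_fst] openin_vietoris
              base_sequence_openin[OF B])
        then have "openin ?P {z \<in> topspace ?P. fst z \<inter> B n \<noteq> {}}"
          by (rule back_subst[of "openin ?P"]) (auto simp: topspace_vietoris)
        then show "analytic_in ?P {z \<in> topspace ?P. fst z \<inter> B n \<noteq> {}}"
          by (rule open_or_closed(3))
        show "analytic_in ?P {z \<in> topspace ?P. g (snd z) n \<notin> fst z}"
          by (rule open_or_closed(3), rule openin_Collect_notin_vietoris[OF Z(1) haus continuous_map_fst Pg])
        show "analytic_in ?P {z \<in> topspace ?P. g (snd z) n \<notin> B n}"
          by (rule open_or_closed(4), rule openin_continuous_map_preimage[OF Pg base_sequence_openin[OF B]])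
      qed
      moreover have "\<not> (?zd K a \<and> ?dense K a) \<longleftrightarrow>
          (\<exists>c. f c \<in> K \<and> \<not> splits_at B (U a) (V a) (f c)) \<or>
          (\<exists>n. K \<inter> B n \<noteq> {} \<and> (g a n \<notin> K \<or> g a n \<notin> B n))" for K a
        by blast
      ultimately show "analytic_in ?P {z \<in> topspace ?P. \<not> (?zd (fst z) (snd z) \<and> ?dense (fst z) (snd z))}"
        by (simp only:) (rule analytic_in_Collect_disj)
    qed
    ultimately show ?thesis by simp
  qed
qed

section \<open>Transfer to arbitrary embeddings into Polish spaces\<close>

theorem proposition6p1:
  fixes X Xhat :: "'a topology"
  assumes "analytic_space TYPE('p) X"
    and "compact_space Xhat" and "metrizable_space Xhat"
    and "topspace X \<subseteq> topspace Xhat" and "X = subtopology Xhat (topspace X)"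
  shows "polish (vietoris Xhat) \<and>
    sigma12_in (vietoris Xhat) ((\<lambda>F. Xhat closure_of F) ` zero_dim_closed_sets X) \<and>
    (\<forall>(P :: 'q topology) e. polish P \<and> embedding_map (admissible_topology Xhat X) P e \<longrightarrow>
      sigma12_in P (e ` zero_dim_closed_sets X))"
proof (intro conjI allI impI)
  let ?V = "vietoris Xhat"
  let ?c = "\<lambda>F. Xhat closure_of F"
  let ?T = "admissible_topology Xhat X"
  show pV: "polish ?V" using assms(2,3) by (rule polish_vietoris)
  show S: "sigma12_in ?V (?c ` zero_dim_closed_sets X)"
    using assms by (rule sigma12_in_closures_zero_dim_closed_sets)
  fix P :: "'q topology" and e
  assume "polish P \<and> embedding_map ?T P e"
  then have mP: "metrizable_space P" and e: "embedding_map ?T P e"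
    by (auto simp: polish_def completely_metrizable_imp_metrizable_space)
  have top: "topspace ?T = closed_sets X"
    using assms(2) by (rule topspace_admissible_topology)
  have ce: "continuous_map ?T P e"
    using e unfolding embedding_map_def
    by (rule continuous_map_into_fulltopology[OF homeomorphic_imp_continuous_map])
  have ePT: "e F \<in> topspace P" if "F \<in> closed_sets X" for F
    using continuous_map_funspace[OF ce] that top by auto
  have cV: "?c F \<in> topspace ?V" for F
    using assms(2) by (simp add: topspace_vietoris closedin_compact_space)
  let ?graph = "(\<lambda>F. (e F, ?c F)) ` closed_sets X"
  \<comment> \<open>The projection lemma needs a closed relation, so the graph is replaced by its
    closure.\<close>
  define G where "G = prod_topology P ?V closure_of ?graph"
  have G_graph: "(e F, ?c F) \<in> G" if "F \<in> closed_sets X" for F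
  proof -
    have "?graph \<subseteq> topspace (prod_topology P ?V)" using ePT cV by auto
    then show ?thesis using closure_of_subset that unfolding G_def by blast
  qed
  \<comment> \<open>Continuity of \<open>e\<close> at \<open>F\<close> is continuity for a
    pulled-back topology: a Vietoris neighbourhood \<open>W'\<close> of the closure of
    \<open>F\<close> forces \<open>e\<close> into \<open>W\<close>. A graph point in
    \<open>U \<times> W'\<close> would then have its first coordinate in both \<open>U\<close> and
    \<open>W\<close>.\<close>
  have G_fun: "p = e F" if p: "(p, ?c F) \<in> G" and F: "F \<in> closed_sets X" for p F
  proof (rule ccontr)
    assume "p \<noteq> e F"
    moreover have "p \<in> topspace P" using p by (auto simp: G_def in_closure_of)
    moreover have "Hausdorff_space P" using mP by (rule metrizable_imp_Hausdorff_space)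
    ultimately obtain U W where UW: "openin P U" "openin P W" "p \<in> U" "e F \<in> W" "disjnt U W"
      using ePT[OF F] unfolding Hausdorff_space_def by meson
    have "openin ?T {F \<in> topspace ?T. e F \<in> W}"
      using ce UW(2) by (rule openin_continuous_map_preimage)
    then obtain W' where W': "openin ?V W'" "{F \<in> closed_sets X. e F \<in> W} = ?c -` W' \<inter> closed_sets X"
      unfolding top by (auto simp: admissible_topology_def openin_pullback_topology)
    have o: "openin (prod_topology P ?V) (U \<times> W')"
      using UW(1) W'(1) by (simp add: openin_prod_Times_iff)
    have m: "(p, ?c F) \<in> U \<times> W'" using UW F W'(2) by blast
    have "\<forall>T. (p, ?c F) \<in> T \<and> openin (prod_topology P ?V) T \<longrightarrow> (\<exists>y. y \<in> ?graph \<and> y \<in> T)"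
      by (rule p[unfolded G_def in_closure_of, THEN conjunct2])
    from mp[OF spec[OF this] conjI[OF m o]]
    obtain F' where "F' \<in> closed_sets X" "e F' \<in> U" "?c F' \<in> W'"
      by auto
    then have "e F' \<in> U \<inter> W" using W'(2) by blast
    then show False using UW(5) by (auto simp: disjnt_iff)
  qed
  have Zsub: "zero_dim_closed_sets X \<subseteq> closed_sets X"
    by (auto simp: zero_dim_closed_sets_def)
  have "sigma12_in P {p \<in> topspace P. \<exists>K\<in>?c ` zero_dim_closed_sets X. (p, K) \<in> G}"
    using pV mP S by (rule sigma12_in_projection) (simp add: G_def)
  moreover have "{p \<in> topspace P. \<exists>K\<in>?c ` zero_dim_closed_sets X. (p, K) \<in> G} = e ` zero_dim_closed_sets X"
    using G_graph G_fun Zsub ePT by blast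
  ultimately show "sigma12_in P (e ` zero_dim_closed_sets X)" by simp
qed

end
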